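(* Let $F$ be a free group on finitely many generators $X_1,\ldots,X_n$, and let $\mathbb{Q}F=\mathbb{Q}\langle X_1,X_1^{-1},\ldots,X_n,X_n^{-1}\rangle$ be its group algebra over $\mathbb{Q}$ (the algebra of noncommutative Laurent polynomials with rational coefficients). Let $d\geq 1$ and let $M$ be a $d\times d$ matrix with entries in $\mathbb{Q}F$. For $n\geq 1$ let $a_n(M)\in\mathbb{Q}$ be the coefficient of the identity element $1\in F$ in the trace $\mathrm{Tr}(M^n)\in\mathbb{Q}F$, and set $$P_M=\exp\Big(\sum_{n\geq 1} a_n(M)\,\frac{t^n}{n}\Big)\in\mathbb{Q}[[t]].$$ Then $P_M$ is algebraic over $\mathbb{Q}(t)$.
   Context: Every element $a\in\mathbb{Q}F$ is uniquely a finite sum $a=\sum_{g\in F}(a,g)\,g$ with $(a,g)\in\mathbb{Q}$; the coefficient of $1$ in $\mathrm{Tr}(M^n)$ means $(\mathrm{Tr}(M^n),1)$. The power series $P_M$ is called the zeta function of $M$. *)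

theory Defs
  imports
    "HOL-Library.Poly_Mapping"
    "HOL-Computational_Algebra.Computational_Algebra"
    "Jordan_Normal_Form.Matrix"
begin

text \<open>
  Groups are written additively (class \<open>group_add\<close>, which is not assumed commutative), because
  \<open>'f \<Rightarrow>\<^sub>0 rat\<close> from \<open>Poly_Mapping\<close> carries the convolution product for an additive monoid of
  exponents. Thus the group law of \<open>F\<close> is \<open>+\<close>, its identity element is \<open>0 :: 'f\<close>, and
  \<open>'f \<Rightarrow>\<^sub>0 rat\<close> is the group algebra of \<open>F\<close> over the rationals, with \<open>Poly_Mapping.lookup a g\<close> the coefficient
  \<open>(a, g)\<close>.

  A word in the generators and their inverses is a list of letters: \<open>(i, True)\<close> stands for the
  generator \<open>X i\<close> and \<open>(i, False)\<close> for its inverse.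
\<close>

definition reduced_word :: "('i \<times> bool) list \<Rightarrow> bool" where
  "reduced_word w \<longleftrightarrow>
     (\<forall>k. Suc k < length w \<longrightarrow>
        \<not> (fst (w ! k) = fst (w ! Suc k) \<and> snd (w ! k) \<noteq> snd (w ! Suc k)))"

fun eval_letter :: "('i \<Rightarrow> 'f::group_add) \<Rightarrow> 'i \<times> bool \<Rightarrow> 'f" where
  "eval_letter X (i, b) = (if b then X i else - X i)"

definition eval_word :: "('i \<Rightarrow> 'f::group_add) \<Rightarrow> ('i \<times> bool) list \<Rightarrow> 'f" where
  "eval_word X w = sum_list (map (eval_letter X) w)"

definition free_on :: "'i set \<Rightarrow> ('i \<Rightarrow> 'f::group_add) \<Rightarrow> bool" where
  "free_on I X \<longleftrightarrow>
     bij_betw (eval_word X) {w. set w \<subseteq> I \<times> UNIV \<and> reduced_word w} UNIV"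

definition mat_trace :: "'a::comm_monoid_add mat \<Rightarrow> 'a" where
  "mat_trace A = (\<Sum>i<dim_row A. A $$ (i, i))"

definition zeta_coeff :: "('f::group_add \<Rightarrow>\<^sub>0 rat) mat \<Rightarrow> nat \<Rightarrow> rat" where
  "zeta_coeff M k = Poly_Mapping.lookup (mat_trace (M ^\<^sub>m k)) 0"

definition zeta_fps :: "('f::group_add \<Rightarrow>\<^sub>0 rat) mat \<Rightarrow> rat fps" where
  "zeta_fps M =
     fps_compose (fps_exp 1) (Abs_fps (\<lambda>k. if k = 0 then 0 else zeta_coeff M k / of_nat k))"

text \<open>The field of rational functions as a subfield of the field of formal Laurent series.\<close>

definition rational_fls :: "'a::field fls set" where
  "rational_fls =
     {fps_to_fls (fps_of_poly p) / fps_to_fls (fps_of_poly q) | p q. q \<noteq> 0}"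

definition algebraic_over :: "'a::field set \<Rightarrow> 'a \<Rightarrow> bool" where
  "algebraic_over K x \<longleftrightarrow> (\<exists>p. (\<forall>i. coeff p i \<in> K) \<and> p \<noteq> 0 \<and> poly p x = 0)"

text \<open>
  The universal property of a free group, confirming that \<^const>\<open>free_on\<close> (unique normal form as
  a reduced word) is the intended notion.
\<close>

lemma reduced_word_Cons:
  "reduced_word (l # w) \<longleftrightarrow>
     reduced_word w \<and> (w = [] \<or> \<not> (fst l = fst (hd w) \<and> snd l \<noteq> snd (hd w)))"
proof (cases w)
  case Nil
  then show ?thesis by (simp add: reduced_word_def)
next
  case (Cons m v)
  show ?thesis
  proof
    assume L: "reduced_word (l # w)"
    have "reduced_word w"
      unfolding reduced_word_def
    proof (intro allI impI)
      fix k assume "Suc k < length w"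
      then show "\<not> (fst (w ! k) = fst (w ! Suc k) \<and> snd (w ! k) \<noteq> snd (w ! Suc k))"
        using L[unfolded reduced_word_def, rule_format, of "Suc k"] by simp
    qed
    moreover have "\<not> (fst l = fst (hd w) \<and> snd l \<noteq> snd (hd w))"
      using L[unfolded reduced_word_def, rule_format, of 0] Cons by simp
    ultimately show "reduced_word w \<and> (w = [] \<or> \<not> (fst l = fst (hd w) \<and> snd l \<noteq> snd (hd w)))"
      by simp
  next
    assume R: "reduced_word w \<and> (w = [] \<or> \<not> (fst l = fst (hd w) \<and> snd l \<noteq> snd (hd w)))"
    show "reduced_word (l # w)"
      unfolding reduced_word_def
    proof (intro allI impI)
      fix k assume "Suc k < length (l # w)"
      then show "\<not> (fst ((l # w) ! k) = fst ((l # w) ! Suc k) \<and>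
          snd ((l # w) ! k) \<noteq> snd ((l # w) ! Suc k))"
        using R Cons by (cases k) (auto simp: reduced_word_def)
    qed
  qed
qed

lemma eval_word_simps [simp]:
  "eval_word X [] = 0"
  "eval_word X (l # w) = eval_letter X l + eval_word X w"
  by (simp_all add: eval_word_def)

lemma free_on_universal:
  fixes X :: "'i \<Rightarrow> 'f::group_add" and Y :: "'i \<Rightarrow> 'g::group_add"
  assumes "free_on I X"
  shows "\<exists>!h. (\<forall>a b. h (a + b) = h a + h b) \<and> (\<forall>i\<in>I. h (X i) = Y i)"
proof -
  let ?R = "{w :: ('i \<times> bool) list. set w \<subseteq> I \<times> UNIV \<and> reduced_word w}"
  have bij: "bij_betw (eval_word X) ?R UNIV"
    using assms by (simp add: free_on_def)
  define nf where "nf = inv_into ?R (eval_word X)"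
  have nf_in: "nf a \<in> ?R" for a
    using bij_betw_inv_into[OF bij] by (auto simp: nf_def bij_betw_def)
  have nf_ev: "eval_word X (nf a) = a" for a
    using bij_betw_inv_into_right[OF bij] by (simp add: nf_def)
  have ev_nf: "nf (eval_word X w) = w" if "w \<in> ?R" for w
    using bij_betw_inv_into_left[OF bij that] by (simp add: nf_def)
  define h where "h a = eval_word Y (nf a)" for a
  have letter: "h (eval_letter X l + a) = eval_letter Y l + h a" if l: "fst l \<in> I" for l a
  proof -
    define w where "w = nf a"
    have w: "w \<in> ?R" "eval_word X w = a"
      using nf_in nf_ev by (auto simp: w_def)
    obtain i b where lib: "l = (i, b)" by (cases l)
    show ?thesis
    proof (cases "reduced_word (l # w)")
      case True
      then have "l # w \<in> ?R" using w l lib by auto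
      from ev_nf[OF this] show ?thesis using w(2) by (simp add: h_def w_def)
    next
      case False
      then obtain v where v: "w = (i, \<not> b) # v"
        using w(1) lib by (cases w) (auto simp: reduced_word_Cons)
      have "v \<in> ?R" using w(1) v by (simp add: reduced_word_Cons)
      moreover have "eval_letter X l + a = eval_word X v"
        by (simp add: w(2)[symmetric] v lib flip: add.assoc)
      moreover have "h a = eval_letter Y (i, \<not> b) + eval_word Y v"
        by (simp add: h_def w_def[symmetric] v)
      ultimately show ?thesis
        using ev_nf by (simp add: h_def lib flip: add.assoc)
    qed
  qed
  have h0: "h 0 = 0"
    using ev_nf[of "[]"] by (simp add: h_def reduced_word_def)
  have word: "h (eval_word X w + a) = eval_word Y w + h a" if "set w \<subseteq> I \<times> UNIV" for w a
    using that by (induction w) (auto simp: letter add.assoc simp del: eval_letter.simps)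
  have hom: "h (a + b) = h a + h b" for a b
    using word[of "nf a" b] nf_in[of a] nf_ev[of a] by (simp add: h_def)
  have gen: "h (X i) = Y i" if "i \<in> I" for i
    using letter[of "(i, True)" 0] that h0 by simp
  show ?thesis
  proof (rule ex1I[of _ h])
    show "(\<forall>a b. h (a + b) = h a + h b) \<and> (\<forall>i\<in>I. h (X i) = Y i)"
      using hom gen by blast
  next
    fix k assume k: "(\<forall>a b. k (a + b) = k a + k b) \<and> (\<forall>i\<in>I. k (X i) = Y i)"
    have "k 0 + k 0 = k 0 + 0" using conjunct1[OF k, rule_format, of 0 0] by simp
    then have k0: "k 0 = 0" by (rule add_left_imp_eq)
    have kminus: "k (- a) = - k a" for a
      using conjunct1[OF k, rule_format, of a "- a"] k0 minus_unique[of "k a" "k (- a)"] by simp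
    have kl: "k (eval_letter X l) = eval_letter Y l" if "fst l \<in> I" for l
      using that k kminus by (cases l) auto
    have kw: "k (eval_word X w) = eval_word Y w" if "set w \<subseteq> I \<times> UNIV" for w
      using that by (induction w) (auto simp: k0 k kl simp del: eval_letter.simps)
    show "k = h"
    proof
      fix a
      show "k a = h a"
        using kw[of "nf a"] nf_in[of a] by (simp add: nf_ev h_def)
    qed
  qed
qed

end

theory Submission
  imports Defs "Jordan_Normal_Form.Char_Poly"
begin

text \<open>
  If \<open>M = P Q\<close>, then the block matrix \<open>N\<close> with rows \<open>(0, P)\<close> and \<open>(Q, 0)\<close> has
  \<open>\<zeta>\<^sub>N(t) = \<zeta>\<^sub>M(t\<^sup>2)\<close>. Splitting words in the middle in this way, one may assume that
  \<open>M = A\<^sub>0 + \<Sum>\<^sub>x A\<^sub>x x\<close>, where \<open>x\<close> runs over the generators and their inverses. Let \<open>F\<^sub>x\<close> be the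
  matrix generating function of the walks on the Cayley tree that reach \<open>x\<close> for the first time, and \<open>G\<close> that of
  the closed walks at the identity. Since the Cayley graph is a tree, the coefficient of \<open>(1 - t M)\<^sup>-\<^sup>1\<close> at a
  reduced word \<open>x\<^sub>1 \<dots> x\<^sub>k\<close> is \<open>F\<^sub>x\<^sub>1 \<dots> F\<^sub>x\<^sub>k G\<close>, and comparing logarithmic derivatives gives
  \<open>\<zeta>\<^sub>M = det G \<cdot> \<Prod>\<^sub>i det (1 - F\<^sub>i F\<^sub>-\<^sub>i)\<close>, with \<open>i\<close> running over the generators.

  The entries of \<open>F\<close> and \<open>t G\<close> solve a system \<open>y\<^sub>i = t q\<^sub>i(y)\<close> with quadratic polynomials \<open>q\<^sub>i\<close>. Such
  solutions are algebraic: for the perturbed system \<open>y\<^sub>i = t (q\<^sub>i(y) + s y\<^sub>i\<^sup>3)\<close> the monomials of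
  degree at most twice the number of unknowns span the algebra generated by the solution over \<open>\<rat>(s, t)\<close>, so every element is
  annihilated by a characteristic polynomial; dividing it by a power of \<open>s\<close> and putting \<open>s = 0\<close> yields an
  equation for the original solution.
\<close>

section \<open>Algebraic power series and quadratic systems\<close>

definition fps_cong :: "nat \<Rightarrow> 'a fps \<Rightarrow> 'a fps \<Rightarrow> bool" where
  "fps_cong n f g \<longleftrightarrow> (\<forall>k<n. f $ k = g $ k)"

lemma fps_cong_refl [simp]: "fps_cong n f f"
  by (simp add: fps_cong_def)

lemma fps_cong_add:
  "fps_cong n f g \<Longrightarrow> fps_cong n f' g' \<Longrightarrow> fps_cong n (f + f') (g + g')"
  by (simp add: fps_cong_def)

lemma fps_cong_mult:
  "fps_cong n f g \<Longrightarrow> fps_cong n f' g' \<Longrightarrow> fps_cong n (f * f') (g * g')"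
  by (auto simp: fps_cong_def fps_mult_nth intro!: sum.cong)

lemma fps_cong_power:
  "fps_cong n f g \<Longrightarrow> fps_cong n (f ^ m) (g ^ m)"
  by (induction m) (auto intro: fps_cong_mult)

lemma fps_cong_sum:
  "(\<And>i. i \<in> A \<Longrightarrow> fps_cong n (f i) (g i)) \<Longrightarrow> fps_cong n (sum f A) (sum g A)"
  by (auto simp: fps_cong_def fps_sum_nth intro!: sum.cong)

lemma fps_cong_X_mult:
  fixes f g :: "'a::comm_ring_1 fps"
  shows "fps_cong n f g \<Longrightarrow> fps_cong (Suc n) (fps_X * f) (fps_X * g)"
  by (auto simp: fps_cong_def)

text \<open>Each application of \<open>\<Phi>\<close> fixes one more coefficient, so the iterates
  from 0 converge coefficientwise, and two fixed points agree to every order.\<close>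

lemma fps_fixpoint_ex1:
  fixes \<Phi> :: "('i \<Rightarrow> 'a::zero fps) \<Rightarrow> 'i \<Rightarrow> 'a fps"
  assumes contr: "\<And>n y z i. (\<And>i. fps_cong n (y i) (z i)) \<Longrightarrow> fps_cong (Suc n) (\<Phi> y i) (\<Phi> z i)"
  shows "\<exists>!y. \<Phi> y = y"
proof -
  define it where "it n = (\<Phi> ^^ n) (\<lambda>_. 0)" for n
  have it_Suc: "it (Suc n) = \<Phi> (it n)" for n
    by (simp add: it_def)
  have st: "fps_cong n (it n i) (it (n + m) i)" for n m i
  proof (induction n arbitrary: i)
    case 0
    then show ?case by (simp add: fps_cong_def)
  next
    case (Suc n)
    then show ?case using contr[of n "it n" "it (n + m)" i] by (simp add: it_Suc)
  qed
  \<comment> \<open>The coefficient at k is settled once k + 1 iterations have been made.\<close>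
  define y where "y i = Abs_fps (\<lambda>k. it (Suc k) i $ k)" for i
  have yit: "fps_cong n (y i) (it n i)" for n i
    unfolding fps_cong_def
  proof (intro allI impI)
    fix k assume "k < n"
    then show "y i $ k = it n i $ k"
      using st[of "Suc k" i "n - Suc k"] by (simp add: y_def fps_cong_def)
  qed
  have "\<Phi> y i $ k = y i $ k" for i k
    using contr[of k y "it k" i, OF yit] by (simp add: fps_cong_def y_def it_Suc)
  then have fp: "\<Phi> y = y"
    by (intro ext fps_ext) simp
  have "z = y" if "\<Phi> z = z" for z
  proof -
    have "fps_cong n (z i) (y i)" for n i
    proof (induction n arbitrary: i)
      case 0
      then show ?case by (simp add: fps_cong_def)
    next
      case (Suc n)
      then show ?case using contr[of n z y i] that fp by simp
    qed
    then show ?thesis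
      by (intro ext fps_ext) (meson fps_cong_def lessI)
  qed
  with fp show ?thesis by blast
qed

text \<open>The coefficient \<open>s\<close> is the perturbation parameter; \<open>s = 0\<close> is the original system.\<close>

definition quad_map ::
  "'i set \<Rightarrow> ('i \<Rightarrow> 'a::comm_ring_1) \<Rightarrow> ('i \<Rightarrow> 'i \<Rightarrow> 'a) \<Rightarrow> ('i \<Rightarrow> 'i \<Rightarrow> 'i \<Rightarrow> 'a) \<Rightarrow> 'a
    \<Rightarrow> ('i \<Rightarrow> 'a fps) \<Rightarrow> 'i \<Rightarrow> 'a fps" where
  "quad_map J c l q s y i =
     fps_const (c i) + (\<Sum>j\<in>J. fps_const (l i j) * y j)
     + (\<Sum>j\<in>J. \<Sum>k\<in>J. fps_const (q i j k) * (y j * y k)) + fps_const s * y i ^ 3"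

text \<open>The factor \<open>fps_X\<close> makes the system contracting. Unknowns outside
  \<open>J\<close> are pinned to 0, so that uniqueness holds for functions on the whole index
  type.\<close>

lemma quad_system_ex1:
  "\<exists>!y. (\<lambda>i. if i \<in> J then fps_X * quad_map J c l q s y i else 0) = y"
proof (rule fps_fixpoint_ex1)
  fix n i and y z :: "'a \<Rightarrow> 'b fps"
  assume "\<And>i. fps_cong n (y i) (z i)"
  then have "fps_cong n (quad_map J c l q s y i) (quad_map J c l q s z i)"
    unfolding quad_map_def
    by (intro fps_cong_add fps_cong_sum fps_cong_mult fps_cong_power fps_cong_refl)
  then show "fps_cong (Suc n) (if i \<in> J then fps_X * quad_map J c l q s y i else 0)
      (if i \<in> J then fps_X * quad_map J c l q s z i else 0)"
    by (simp add: fps_cong_X_mult)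
qed

section \<open>Linear spans and the determinant criterion for integrality\<close>

text \<open>Here \<open>R\<close> is a mere set, in practice the image of a ring of polynomials in a
  ring of power series; its closure properties enter as hypotheses of the lemmas.\<close>

inductive_set lin_span :: "'a::comm_ring_1 set \<Rightarrow> 'a set \<Rightarrow> 'a set" for R B where
  zero: "0 \<in> lin_span R B"
| step: "r \<in> R \<Longrightarrow> b \<in> B \<Longrightarrow> z \<in> lin_span R B \<Longrightarrow> r * b + z \<in> lin_span R B"

lemma lin_span_add:
  "x \<in> lin_span R B \<Longrightarrow> y \<in> lin_span R B \<Longrightarrow> x + y \<in> lin_span R B"
  by (induction rule: lin_span.induct) (auto simp: add.assoc intro: lin_span.intros)

lemma lin_span_base: "r \<in> R \<Longrightarrow> b \<in> B \<Longrightarrow> r * b \<in> lin_span R B"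
  using lin_span.step[OF _ _ lin_span.zero] by fastforce

lemma lin_span_scale:
  assumes "\<And>a b. a \<in> R \<Longrightarrow> b \<in> R \<Longrightarrow> a * b \<in> R" "r \<in> R"
  shows "x \<in> lin_span R B \<Longrightarrow> r * x \<in> lin_span R B"
  by (induction rule: lin_span.induct)
     (auto simp: distrib_left simp flip: mult.assoc intro: lin_span.intros assms)

lemma lin_span_mult:
  assumes R: "\<And>a b. a \<in> R \<Longrightarrow> b \<in> R \<Longrightarrow> a * b \<in> R"
    and B: "\<And>a b. a \<in> B \<Longrightarrow> b \<in> B \<Longrightarrow> a * b \<in> B"
    and x: "x \<in> lin_span R B" and y: "y \<in> lin_span R B"
  shows "x * y \<in> lin_span R B"
proof -
  have *: "(r * b) * y \<in> lin_span R B" if "r \<in> R" "b \<in> B" for r b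
    using y
  proof (induction rule: lin_span.induct)
    case zero
    then show ?case by (simp add: lin_span.zero)
  next
    case (step r' b' z)
    have "(r * r') * (b * b') + r * b * z \<in> lin_span R B"
      using that step by (intro lin_span.step) (auto intro: R B)
    then show ?case by (simp add: algebra_simps)
  qed
  from x show ?thesis
    by (induction rule: lin_span.induct)
       (auto simp: distrib_right intro: lin_span.zero lin_span_add *)
qed

lemma lin_span_finiteE:
  assumes "z \<in> lin_span R B" "finite B" "0 \<in> R" "\<And>a b. a \<in> R \<Longrightarrow> b \<in> R \<Longrightarrow> a + b \<in> R"
  obtains a where "\<And>b. a b \<in> R" "z = (\<Sum>b\<in>B. a b * b)"
proof -
  from assms(1) have "\<exists>a. (\<forall>b. a b \<in> R) \<and> z = (\<Sum>b\<in>B. a b * b)"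
  proof (induction rule: lin_span.induct)
    case zero
    show ?case using assms(3) by (intro exI[of _ "\<lambda>_. 0"]) auto
  next
    case (step r b z)
    then obtain a where a: "\<forall>b. a b \<in> R" "z = (\<Sum>b\<in>B. a b * b)" by blast
    have "(\<Sum>b'\<in>B. (a(b := r + a b)) b' * b') = (\<Sum>b'\<in>B. (if b' = b then r * b else 0) + a b' * b')"
      by (intro sum.cong) (auto simp: distrib_right)
    also have "\<dots> = r * b + z"
      using step(2) assms(2) by (simp add: sum.distrib a)
    finally show ?case
      using a step(1) assms(4) by (intro exI[of _ "a(b := r + a b)"]) auto
  qed
  with that show ?thesis by blast
qed

lemma comm_ring_hom_poly_map_poly:
  assumes "comm_ring_hom (h :: 'r::comm_ring_1 \<Rightarrow> 'a::comm_ring_1)"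
  shows "comm_ring_hom (\<lambda>q. poly (map_poly h q) z)"
proof -
  interpret comm_ring_hom h by fact
  interpret mp: map_poly_comm_ring_hom h ..
  show ?thesis by unfold_locales (simp_all add: mp.hom_mult mp.hom_add)
qed

text \<open>The determinant trick: multiplication by \<open>z\<close> acts on the spanning family
  \<open>B\<close> by a matrix over the base ring, and \<open>z\<close> is a root of its
  characteristic polynomial.\<close>

lemma stable_span_imp_integral:
  fixes h :: "'r::comm_ring_1 \<Rightarrow> 'a::idom"
  assumes h: "comm_ring_hom h" and B: "finite B" "1 \<in> B"
    and stable: "\<And>b. b \<in> B \<Longrightarrow> z * b \<in> lin_span (range h) B"
  shows "\<exists>p. lead_coeff p = 1 \<and> poly (map_poly h p) z = 0"
proof -
  interpret h: comm_ring_hom h by fact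
  interpret ev: comm_ring_hom "\<lambda>q. poly (map_poly h q) z"
    by (rule comm_ring_hom_poly_map_poly[OF h])
  define n where "n = card B"
  obtain f where f: "bij_betw f {0..<n} B"
    using ex_bij_betw_nat_finite[OF B(1)] unfolding n_def by blast
  have "\<exists>a. z * f i = (\<Sum>j=0..<n. h (a j) * f j)" if "i < n" for i
  proof -
    have "f i \<in> B" using f that by (auto simp: bij_betw_def)
    from stable[OF this] obtain a where a: "\<And>b. a b \<in> range h" "z * f i = (\<Sum>b\<in>B. a b * b)"
    proof (rule lin_span_finiteE[OF _ B(1)])
      show "0 \<in> range h" by (metis h.hom_zero rangeI)
      show "a + b \<in> range h" if "a \<in> range h" "b \<in> range h" for a b
      proof -
        from that obtain x y where "a = h x" "b = h y" by blast
        then have "a + b = h (x + y)" by (simp add: h.hom_add)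
        then show ?thesis by blast
      qed
    qed blast
    from a(1) have "\<forall>b. \<exists>x. a b = h x" by (auto simp: image_iff)
    from choice[OF this] obtain a' where "\<And>b. a b = h (a' b)" by blast
    with a(2) have "z * f i = (\<Sum>j=0..<n. h (a' (f j)) * f j)"
      using sum.reindex_bij_betw[OF f, of "\<lambda>b. a b * b"] by simp
    then show ?thesis by (intro exI[of _ "\<lambda>j. a' (f j)"]) simp
  qed
  then obtain A where A: "\<And>i. i < n \<Longrightarrow> z * f i = (\<Sum>j=0..<n. h (A i j) * f j)" by metis
  define Am where "Am = mat n n (\<lambda>(i, j). A i j)"
  have Am: "Am \<in> carrier_mat n n" by (simp add: Am_def)
  \<comment> \<open>\<open>C\<close> is z times the identity minus the image of \<open>Am\<close>;
    it kills the vector of elements of \<open>B\<close>, which is nonzero because 1 occurs in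
    it.\<close>
  define C where "C = map_mat (\<lambda>q. poly (map_poly h q) z) (char_poly_matrix Am)"
  have C: "C \<in> carrier_mat n n" using Am by (simp add: C_def char_poly_matrix_def)
  have C_entry: "C $$ (i, j) = (if i = j then z else 0) - h (A i j)" if "i < n" "j < n" for i j
    using that Am by (simp add: C_def char_poly_matrix_def Am_def h.map_poly_pCons_hom h.hom_uminus)
  define v where "v = vec n f"
  have "C *\<^sub>v v = 0\<^sub>v n"
  proof (rule eq_vecI)
    fix i assume "i < dim_vec (0\<^sub>v n :: 'a vec)"
    then have i: "i < n" by simp
    have "(C *\<^sub>v v) $ i = (\<Sum>j=0..<n. C $$ (i, j) * f j)"
      using i C by (auto simp: scalar_prod_def v_def intro!: sum.cong)
    also have "\<dots> = (\<Sum>j=0..<n. (if j = i then z * f i else 0) - h (A i j) * f j)"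
      using i by (intro sum.cong) (auto simp: C_entry left_diff_distrib)
    also have "\<dots> = 0" using i A[OF i] by (simp add: sum_subtractf)
    finally show "(C *\<^sub>v v) $ i = 0\<^sub>v n $ i" using i by simp
  qed (use C in auto)
  moreover have "v \<noteq> 0\<^sub>v n"
  proof -
    obtain i where "i < n" "f i = 1" using f B(2) by (auto simp: bij_betw_def image_iff)
    then have "v $ i \<noteq> 0\<^sub>v n $ i" by (simp add: v_def)
    then show ?thesis by auto
  qed
  moreover have "v \<in> carrier_vec n" by (simp add: v_def)
  ultimately have "det C = 0" using det_0_iff_vec_prod_zero[OF C] by blast
  then have "poly (map_poly h (char_poly Am)) z = 0"
    by (simp add: C_def char_poly_def)
  moreover have "lead_coeff (char_poly Am) = 1"
    using degree_monic_char_poly[OF Am] by auto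
  ultimately show ?thesis by blast
qed

section \<open>Specialisation of the parameter and algebraic series\<close>

text \<open>The coefficients are polynomials in the perturbation parameter s; this is the
  substitution s = 0.\<close>

definition fps_at0 :: "'a::comm_ring_1 poly fps \<Rightarrow> 'a fps" where
  "fps_at0 f = Abs_fps (\<lambda>n. poly (f $ n) 0)"

lemma fps_at0_nth [simp]: "fps_at0 f $ n = poly (f $ n) 0"
  by (simp add: fps_at0_def)

lemma fps_at0_0 [simp]: "fps_at0 0 = 0"
  and fps_at0_add: "fps_at0 (f + g) = fps_at0 f + fps_at0 g"
  and fps_at0_mult: "fps_at0 (f * g) = fps_at0 f * fps_at0 g"
  and fps_at0_const: "fps_at0 (fps_const a) = fps_const (poly a 0)"
  by (auto intro!: fps_ext simp: fps_mult_nth poly_sum)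

lemma fps_at0_1 [simp]: "fps_at0 1 = 1"
  and fps_at0_uminus: "fps_at0 (- f) = - fps_at0 f"
  and fps_at0_X [simp]: "fps_at0 fps_X = fps_X"
  by (auto intro!: fps_ext simp: fps_X_def)

lemma fps_at0_sum: "fps_at0 (sum f A) = (\<Sum>i\<in>A. fps_at0 (f i))"
  by (induction A rule: infinite_finite_induct) (auto simp: fps_at0_add)

lemma fps_at0_power: "fps_at0 (f ^ n) = fps_at0 f ^ n"
  by (induction n) (auto simp: fps_at0_mult)

text \<open>Denominators are cleared in advance, so the notion makes sense over any commutative
  ring.\<close>

definition fps_algebraic :: "'a::comm_ring_1 fps \<Rightarrow> bool" where
  "fps_algebraic f \<longleftrightarrow> (\<exists>p. p \<noteq> 0 \<and> poly (map_poly fps_of_poly p) f = 0)"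

lemma comm_ring_hom_fps_of_poly: "comm_ring_hom (fps_of_poly :: 'a::comm_ring_1 poly \<Rightarrow> 'a fps)"
  by unfold_locales (simp_all add: fps_of_poly_add fps_of_poly_mult)

lemma fps_at0_fps_of_poly: "fps_at0 (fps_of_poly p) = fps_of_poly (map_poly (\<lambda>a. poly a 0) p)"
  by (rule fps_ext) (simp add: coeff_map_poly)

text \<open>The outermost variable is the unknown, the middle one is t and the innermost one is s,
  which is set to 0.\<close>

definition poly_at0 :: "'a::comm_ring_1 poly poly poly \<Rightarrow> 'a poly poly" where
  "poly_at0 = map_poly (map_poly (\<lambda>a. poly a 0))"

lemma coeff_poly_at0: "coeff (coeff (poly_at0 p) i) j = poly (coeff (coeff p i) j) 0"
  by (simp add: poly_at0_def coeff_map_poly)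

lemma poly_at0_pCons: "poly_at0 (pCons a p) = pCons (map_poly (\<lambda>a. poly a 0) a) (poly_at0 p)"
  by (rule poly_eqI, rule poly_eqI) (simp add: coeff_poly_at0 coeff_pCons coeff_map_poly split: nat.split)

lemma fps_at0_poly:
  "fps_at0 (poly (map_poly fps_of_poly p) z) = poly (map_poly fps_of_poly (poly_at0 p)) (fps_at0 z)"
proof (induction p)
  case 0
  then show ?case by (simp add: poly_at0_def)
next
  case (pCons a p)
  interpret h: comm_ring_hom "fps_of_poly :: 'a poly \<Rightarrow> 'a fps"
    by (rule comm_ring_hom_fps_of_poly)
  interpret h2: comm_ring_hom "fps_of_poly :: 'a poly poly \<Rightarrow> 'a poly fps"
    by (rule comm_ring_hom_fps_of_poly)
  from pCons show ?case
    by (simp add: poly_at0_pCons h.map_poly_pCons_hom h2.map_poly_pCons_hom fps_at0_add fps_at0_mult fps_at0_fps_of_poly)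
qed

text \<open>Powers of the parameter are divided out before it is set to zero.\<close>

lemma fps_algebraic_at0_if_annihilated:
  fixes z :: "'a::idom poly fps"
  assumes "p \<noteq> 0" "poly (map_poly fps_of_poly p) z = 0"
  shows "fps_algebraic (fps_at0 z)"
proof -
  have "fps_algebraic (fps_at0 z)"
    if "coeff (coeff p i) j \<noteq> 0" "poly (map_poly fps_of_poly p) z = 0" for p i j
    using that
  \<comment> \<open>One nonzero coefficient, at fixed positions i and j, is followed: each division
    by s lowers its degree in s, so the process stops.\<close>
  proof (induction "degree (coeff (coeff p i) j)" arbitrary: p rule: less_induct)
    case less
    show ?case
    proof (cases "poly_at0 p = 0")
      case False
      then show ?thesis using fps_at0_poly[of p z] less.prems(2) by (auto simp: fps_algebraic_def)
    next
      case True
      \<comment> \<open>Since p vanishes at s = 0, every coefficient is divisible by s, and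
        \<open>poly_shift 1\<close> carries out the division.\<close>
      define p1 where "p1 = map_poly (map_poly (poly_shift 1)) p"
      have c1: "coeff (coeff p1 i) j = poly_shift 1 (coeff (coeff p i) j)" for i j
        by (simp add: p1_def coeff_map_poly)
      have shift: "coeff (coeff p i) j = pCons 0 (poly_shift 1 (coeff (coeff p i) j))" for i j
      proof -
        have "coeff (coeff (coeff p i) j) 0 = 0"
          using coeff_poly_at0[of p i j] True by (simp add: poly_0_coeff_0)
        then show ?thesis
          by (intro poly_eqI) (auto simp: coeff_pCons coeff_poly_shift split: nat.split)
      qed
      have p: "p = Polynomial.smult [:[:0, 1:]:] p1"
      proof (rule poly_eqI, rule poly_eqI)
        fix i j
        show "coeff (coeff p i) j = coeff (coeff (Polynomial.smult [:[:0, 1:]:] p1) i) j"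
          using shift[of i j] by (simp add: c1)
      qed
      interpret comm_ring_hom "fps_of_poly :: 'a poly poly \<Rightarrow> 'a poly fps"
        by (rule comm_ring_hom_fps_of_poly)
      have "fps_of_poly [:[:0, 1:]:] * poly (map_poly fps_of_poly p1) z = 0"
        using less.prems(2) unfolding p by (simp add: map_poly_hom_smult)
      moreover have "fps_of_poly [:[:0, 1::'a:]:] \<noteq> 0"
        by (simp add: fps_of_poly_const)
      ultimately have "poly (map_poly fps_of_poly p1) z = 0" by simp
      moreover have "coeff (coeff p1 i) j \<noteq> 0"
        using less.prems(1) shift[of i j] by (auto simp: c1)
      moreover have "degree (coeff (coeff p1 i) j) < degree (coeff (coeff p i) j)"
        using calculation(2) shift[of i j] unfolding c1 by (metis degree_pCons_eq lessI)
      ultimately show ?thesis using less.hyps by blast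
    qed
  qed
  moreover obtain i j where "coeff (coeff p i) j \<noteq> 0"
    using assms(1) by (metis leading_coeff_0_iff)
  ultimately show ?thesis using assms(2) by blast
qed

section \<open>Rings generated by solutions of quadratic systems\<close>

inductive_set gen_ring :: "'a::comm_ring_1 set \<Rightarrow> 'a set" for G where
  gen: "g \<in> G \<Longrightarrow> g \<in> gen_ring G"
| one: "1 \<in> gen_ring G"
| add: "x \<in> gen_ring G \<Longrightarrow> y \<in> gen_ring G \<Longrightarrow> x + y \<in> gen_ring G"
| uminus: "x \<in> gen_ring G \<Longrightarrow> - x \<in> gen_ring G"
| mult: "x \<in> gen_ring G \<Longrightarrow> y \<in> gen_ring G \<Longrightarrow> x * y \<in> gen_ring G"

lemma gen_ring_zero: "0 \<in> gen_ring G"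
  using gen_ring.add[OF gen_ring.one gen_ring.uminus[OF gen_ring.one]] by simp

lemma gen_ring_diff: "x \<in> gen_ring G \<Longrightarrow> y \<in> gen_ring G \<Longrightarrow> x - y \<in> gen_ring G"
  using gen_ring.add[OF _ gen_ring.uminus] by fastforce

lemma gen_ring_sum: "(\<And>i. i \<in> A \<Longrightarrow> f i \<in> gen_ring G) \<Longrightarrow> sum f A \<in> gen_ring G"
  by (induction A rule: infinite_finite_induct) (auto intro: gen_ring_zero gen_ring.add)

lemma gen_ring_prod: "(\<And>i. i \<in> A \<Longrightarrow> f i \<in> gen_ring G) \<Longrightarrow> prod f A \<in> gen_ring G"
  by (induction A rule: infinite_finite_induct) (auto intro: gen_ring.one gen_ring.mult)

text \<open>Specialisation is a ring homomorphism, so a polynomial expression in the original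
  solution lifts to the same expression in the perturbed one.\<close>

lemma gen_ring_fps_at0_lift:
  assumes "z \<in> gen_ring (fps_at0 ` G)"
  shows "\<exists>z'\<in>gen_ring G. fps_at0 z' = z"
  using assms
proof (induction rule: gen_ring.induct)
  case one
  then show ?case by (metis fps_at0_1 gen_ring.one)
next
  case (add x y)
  then show ?case by (metis fps_at0_add gen_ring.add)
next
  case (uminus x)
  then show ?case by (metis fps_at0_uminus gen_ring.uminus)
next
  case (mult x y)
  then show ?case by (metis fps_at0_mult gen_ring.mult)
qed (auto intro: gen_ring.gen)

text \<open>The perturbation makes s t w_i^3 equal to w_i minus t times a quadratic polynomial in w.
  After inverting s t, cubes can thus be eliminated from all monomials, leaving a finite spanning
  set; the determinant trick and the specialisation s = 0 then apply.\<close>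

lemma quad_system_gen_ring_algebraic:
  fixes y :: "'i \<Rightarrow> 'a::idom fps"
  assumes J: "finite J"
    and y: "\<And>i. i \<in> J \<Longrightarrow> y i = fps_X * quad_map J c l q 0 y i"
    and z: "z \<in> gen_ring (y ` J)"
  shows "fps_algebraic z"
proof -
  let ?qm = "quad_map J (\<lambda>i. [:c i:]) (\<lambda>i j. [:l i j:]) (\<lambda>i j k. [:q i j k:]) [:0, 1:]"
  obtain w where w0: "(\<lambda>i. if i \<in> J then fps_X * ?qm w i else 0) = w"
    using quad_system_ex1 by blast
  have w: "fps_X * ?qm w i = w i" if "i \<in> J" for i
    using fun_cong[OF w0, of i] by (simp only: that if_True)
  \<comment> \<open>The specialised solution solves the original system, hence equals
    \<open>y\<close> on \<open>J\<close> by uniqueness.\<close>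
  have at0_w: "fps_at0 (w i) = y i" if "i \<in> J" for i
  proof -
    let ?sol = "\<lambda>u. (\<lambda>i. if i \<in> J then fps_X * quad_map J c l q 0 u i else 0) = u"
    define u where "u i = (if i \<in> J then y i else 0)" for i
    define v where "v i = (if i \<in> J then fps_at0 (w i) else 0)" for i
    have "?sol u"
    proof
      fix i
      have "quad_map J c l q 0 u i = quad_map J c l q 0 y i" if "i \<in> J"
        using that by (simp add: quad_map_def u_def)
      then show "(if i \<in> J then fps_X * quad_map J c l q 0 u i else 0) = u i"
        using y[of i] by (simp add: u_def)
    qed
    moreover have "?sol v"
    proof
      fix i
      have "fps_at0 (w i) = fps_X * quad_map J c l q 0 v i" if "i \<in> J"
        using that by (subst w[OF that, symmetric])
          (simp add: quad_map_def v_def fps_at0_mult fps_at0_add fps_at0_sum fps_at0_const fps_at0_power)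
      then show "(if i \<in> J then fps_X * quad_map J c l q 0 v i else 0) = v i"
        by (simp add: v_def)
    qed
    ultimately have "u = v" using quad_system_ex1[of J c l q 0] by blast
    from fun_cong[OF this, of i] show ?thesis using that by (simp add: u_def v_def)
  qed

  define R where "R = range (fps_of_poly :: 'a poly poly \<Rightarrow> 'a poly fps)"
  have R_mult: "a * b \<in> R" if "a \<in> R" "b \<in> R" for a b
    using that by (auto simp: R_def simp flip: fps_of_poly_mult)
  have R_uminus: "- a \<in> R" if "a \<in> R" for a
    using that by (auto simp: R_def simp flip: fps_of_poly_uminus)
  have R_const: "fps_const a \<in> R" for a
    unfolding R_def by (metis fps_of_poly_const rangeI)
  have R_X: "fps_X \<in> R"
    unfolding R_def by (metis fps_of_poly_fps_X rangeI)
  have R_1: "1 \<in> R" using R_const[of 1] by simp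
  have R_pow: "a ^ n \<in> R" if "a \<in> R" for a n
    by (induction n) (auto intro: R_1 R_mult that)

  define mon where "mon M = prod_mset (image_mset w M)" for M
  have mon_add: "mon (M + N) = mon M * mon N" for M N
    by (simp add: mon_def)
  define mons where "mons = mon ` {M. set_mset M \<subseteq> J}"
  \<comment> \<open>A monomial of degree above \<open>2 * card J\<close> contains some unknown at
    least three times.\<close>
  define B where "B = mon ` {M. set_mset M \<subseteq> J \<and> size M \<le> 2 * card J}"
  have finB: "finite B"
  proof -
    have "{M. set_mset M \<subseteq> J \<and> size M \<le> 2 * card J}
        \<subseteq> mset ` {xs. set xs \<subseteq> J \<and> length xs \<le> 2 * card J}"
    proof
      fix M assume M: "M \<in> {M. set_mset M \<subseteq> J \<and> size M \<le> 2 * card J}"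
      obtain xs where "mset xs = M" using ex_mset by blast
      with M show "M \<in> mset ` {xs. set xs \<subseteq> J \<and> length xs \<le> 2 * card J}" by auto
    qed
    then show ?thesis
      unfolding B_def using finite_lists_length_le[OF J] by (meson finite_imageI finite_subset)
  qed
  have oneB: "1 \<in> B" unfolding B_def by (rule image_eqI[of _ _ "{#}"]) (auto simp: mon_def)

  define \<sigma> where "\<sigma> = fps_X * fps_const [:0, 1 :: 'a:]"
  have \<sigma>: "\<sigma> \<in> R" unfolding \<sigma>_def by (intro R_mult R_X R_const)
  \<comment> \<open>\<open>Q\<close> is membership in the span of \<open>B\<close> after inverting
    \<sigma> = s t.\<close>
  define Q where "Q z \<longleftrightarrow> (\<exists>N. \<sigma> ^ N * z \<in> lin_span R B)" for z
  have Q_mono: "\<sigma> ^ (N + k) * z \<in> lin_span R B" if "\<sigma> ^ N * z \<in> lin_span R B" for N k z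
    using lin_span_scale[OF R_mult R_pow[OF \<sigma>] that, of k]
    by (simp add: power_add mult_ac)
  have Q_0: "Q 0" by (auto simp: Q_def intro: lin_span.zero)
  have Q_add: "Q (a + b)" if "Q a" "Q b" for a b
  proof -
    from that obtain m n where mn: "\<sigma> ^ m * a \<in> lin_span R B" "\<sigma> ^ n * b \<in> lin_span R B"
      by (auto simp: Q_def)
    then have "\<sigma> ^ (m + n) * a + \<sigma> ^ (m + n) * b \<in> lin_span R B"
      using Q_mono[OF mn(1), of n] Q_mono[OF mn(2), of m] by (intro lin_span_add) (auto simp: add.commute)
    then show ?thesis by (auto simp: Q_def distrib_left)
  qed
  have Q_scale: "Q (r * a)" if r: "r \<in> R" and a: "Q a" for r a
  proof -
    from a obtain m where "\<sigma> ^ m * a \<in> lin_span R B" by (auto simp: Q_def)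
    from lin_span_scale[OF R_mult r this] show ?thesis
      by (auto simp: Q_def mult_ac)
  qed
  have Q_uminus: "Q (- a)" if "Q a" for a
    using Q_scale[OF R_uminus[OF R_1] that] by simp
  have Q_diff: "Q (a - b)" if "Q a" "Q b" for a b
    using Q_add[OF that(1) Q_uminus[OF that(2)]] by simp
  have Q_sum: "Q (sum f A)" if "\<And>i. i \<in> A \<Longrightarrow> Q (f i)" for f and A :: "'i set"
    using that by (induction A rule: infinite_finite_induct) (auto intro: Q_0 Q_add)

  have Q_mon: "Q (mon M)" if "set_mset M \<subseteq> J" for M
    using that
  proof (induction "size M" arbitrary: M rule: less_induct)
    case less
    show ?case
    proof (cases "size M \<le> 2 * card J")
      case True
      then have "mon M \<in> B" using less.prems by (auto simp: B_def)
      then have "1 * mon M \<in> lin_span R B" by (intro lin_span_base R_1)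
      then show ?thesis unfolding Q_def by (intro exI[of _ 0]) simp
    next
      case False
      have "\<exists>i\<in>J. count M i \<ge> 3"
      proof (rule ccontr)
        assume "\<not> ?thesis"
        then have "(\<Sum>i\<in>J. count M i) \<le> (\<Sum>i\<in>J. 2)" by (intro sum_mono) force
        moreover have "size M = (\<Sum>i\<in>J. count M i)"
          unfolding size_multiset_overloaded_eq
          using less.prems J by (intro sum.mono_neutral_left) (auto simp: not_in_iff)
        ultimately show False using False by simp
      qed
      then obtain i where i: "i \<in> J" "count M i \<ge> 3" by blast
      then have "replicate_mset 3 i \<subseteq># M" by (simp add: count_le_replicate_mset_subset_eq)
      then obtain M' where M: "M = replicate_mset 3 i + M'" by (metis subset_mset.le_iff_add)
      have M': "set_mset M' \<subseteq> J" using less.prems M by auto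
      have sz: "size M = size M' + 3" by (simp add: M)
      have monM: "mon M = w i ^ 3 * mon M'" by (simp add: M mon_add mon_def)
      have Q0: "Q (mon M')" using less.hyps[of M'] M' sz by simp
      have Q1: "Q (w j * mon M')" if "j \<in> J" for j
        using less.hyps[of "{#j#} + M'"] M' sz that by (simp add: mon_def)
      have Q2: "Q (w j * w k * mon M')" if "j \<in> J" "k \<in> J" for j k
        using less.hyps[of "{#j, k#} + M'"] M' sz that by (simp add: mon_def mult.assoc)
      \<comment> \<open>The perturbed equation for \<open>w i\<close> replaces the cube; every
        monomial on the right has smaller degree than \<open>M\<close>.\<close>
      have "\<sigma> * mon M = w i * mon M' - fps_X * (fps_const [:c i:] * mon M'
          + (\<Sum>j\<in>J. fps_const [:l i j:] * (w j * mon M'))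
          + (\<Sum>j\<in>J. \<Sum>k\<in>J. fps_const [:q i j k:] * (w j * w k * mon M')))"
      proof -
        have "w i * mon M' = fps_X * ?qm w i * mon M'" using w[OF i(1)] by simp
        then show ?thesis
          by (simp add: quad_map_def \<sigma>_def monM algebra_simps sum_distrib_left sum_distrib_right)
      qed
      moreover have "Q \<dots>"
        by (intro Q_diff Q_add Q_scale[OF R_X] Q_scale[OF R_const] Q_sum Q0 Q1 Q2 i)
      ultimately have "Q (\<sigma> * mon M)" by simp
      then obtain n where "\<sigma> ^ n * (\<sigma> * mon M) \<in> lin_span R B" by (auto simp: Q_def)
      then have "\<sigma> ^ Suc n * mon M \<in> lin_span R B" by (simp add: mult_ac)
      then show ?thesis unfolding Q_def by blast
    qed
  qed
  have Q_span: "Q a" if "a \<in> lin_span R mons" for a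
    using that by (induction rule: lin_span.induct) (auto simp: mons_def intro: Q_0 Q_add Q_scale Q_mon)

  have mons_mult: "a * b \<in> mons" if "a \<in> mons" "b \<in> mons" for a b
  proof -
    from that obtain M N where "a = mon M" "b = mon N" "set_mset M \<subseteq> J" "set_mset N \<subseteq> J"
      by (auto simp: mons_def)
    then show ?thesis unfolding mons_def by (intro image_eqI[of _ _ "M + N"]) (auto simp: mon_add)
  qed
  have B_mons: "b \<in> lin_span R mons" if "b \<in> mons" for b
    using lin_span_base[OF R_1 that] by simp
  have one_mons: "1 \<in> mons" unfolding mons_def by (rule image_eqI[of _ _ "{#}"]) (auto simp: mon_def)
  have ring_span: "a \<in> lin_span R mons" if "a \<in> gen_ring (w ` J)" for a
    using that
  proof (induction rule: gen_ring.induct)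
    case (gen g)
    then obtain j where "j \<in> J" "g = mon {#j#}" by (auto simp: mon_def)
    then show ?case by (intro B_mons) (auto simp: mons_def)
  next
    case one
    then show ?case by (intro B_mons one_mons)
  next
    case (uminus x)
    then show ?case using lin_span_scale[OF R_mult R_uminus[OF R_1], of x mons] by simp
  qed (auto intro: lin_span_add lin_span_mult R_mult mons_mult)

  have "fps_at0 ` (w ` J) = y ` J" using at0_w by (force simp: image_image)
  then obtain x where x: "x \<in> gen_ring (w ` J)" "fps_at0 x = z"
    using gen_ring_fps_at0_lift[of z "w ` J"] z by auto
  have "\<exists>N. \<forall>b\<in>B. \<sigma> ^ N * (x * b) \<in> lin_span R B"
  proof -
    have "Q (x * b)" if "b \<in> B" for b
      using that by (intro Q_span lin_span_mult R_mult mons_mult ring_span x(1) B_mons)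
        (auto simp: B_def mons_def)
    then obtain N where N: "\<And>b. b \<in> B \<Longrightarrow> \<sigma> ^ N b * (x * b) \<in> lin_span R B"
      unfolding Q_def by metis
    \<comment> \<open>As \<open>B\<close> is finite, the sum of the individual exponents serves all
      of its elements at once.\<close>
    have "\<sigma> ^ sum N B * (x * b) \<in> lin_span R B" if "b \<in> B" for b
      using Q_mono[OF N[OF that], of "sum N (B - {b})"] sum.remove[OF finB that, of N] by simp
    then show ?thesis by blast
  qed
  then obtain N where N: "\<And>b. b \<in> B \<Longrightarrow> (\<sigma> ^ N * x) * b \<in> lin_span R B"
    by (auto simp: mult.assoc)
  from stable_span_imp_integral[OF comm_ring_hom_fps_of_poly finB oneB N[unfolded R_def]]
  obtain p where p: "lead_coeff p = 1" "poly (map_poly fps_of_poly p) (\<sigma> ^ N * x) = 0" by blast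
  interpret h: comm_ring_hom "fps_of_poly :: 'a poly poly \<Rightarrow> 'a poly fps"
    by (rule comm_ring_hom_fps_of_poly)
  define s0 :: "'a poly poly" where "s0 = [:0, [:0, 1:]:]"
  have s0: "fps_of_poly s0 = \<sigma>"
    by (simp add: s0_def \<sigma>_def fps_of_poly_pCons mult.commute)
  \<comment> \<open>Substituting \<sigma>^N times the variable turns an equation for \<sigma>^N x
    into one for x.\<close>
  define p' where "p' = pcompose p [:0, s0 ^ N:]"
  have "p \<noteq> 0" using p(1) by auto
  moreover have "degree [:0, s0 ^ N:] > 0" by (simp add: s0_def)
  ultimately have "p' \<noteq> 0" unfolding p'_def by (simp add: pcompose_eq_0_iff)
  moreover have "poly (map_poly fps_of_poly p') x = 0"
    using p(2) by (simp add: p'_def h.map_poly_pcompose poly_pcompose h.map_poly_pCons_hom h.hom_power s0 mult.commute)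
  ultimately have "fps_algebraic (fps_at0 x)" by (rule fps_algebraic_at0_if_annihilated)
  with x(2) show ?thesis by simp
qed

section \<open>Traces and determinants of matrices of power series\<close>

lemma mult_mat_entry:
  "i < n \<Longrightarrow> j < m \<Longrightarrow> A \<in> carrier_mat n k \<Longrightarrow> B \<in> carrier_mat k m \<Longrightarrow>
    (A * B) $$ (i, j) = (\<Sum>e<k. A $$ (i, e) * B $$ (e, j))"
  by (auto simp: scalar_prod_def atLeast0LessThan intro!: sum.cong)

lemma mat_trace_mult:
  "A \<in> carrier_mat n m \<Longrightarrow> B \<in> carrier_mat m n \<Longrightarrow>
    mat_trace (A * B) = (\<Sum>i<n. \<Sum>j<m. A $$ (i, j) * B $$ (j, i))"
  by (auto simp: mat_trace_def mult_mat_entry[of _ n _ n _ m] simp del: index_mult_mat(1) intro!: sum.cong)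

lemma mat_trace_mult_comm:
  fixes A B :: "'a::comm_semiring_0 mat"
  assumes "A \<in> carrier_mat n m" "B \<in> carrier_mat m n"
  shows "mat_trace (A * B) = mat_trace (B * A)"
  unfolding mat_trace_mult[OF assms] mat_trace_mult[OF assms(2,1)]
  by (subst sum.swap) (simp add: mult.commute)

lemma mat_trace_add:
  "A \<in> carrier_mat n n \<Longrightarrow> B \<in> carrier_mat n n \<Longrightarrow> mat_trace (A + B) = mat_trace A + mat_trace B"
  by (auto simp: mat_trace_def sum.distrib)

lemma mat_trace_uminus:
  fixes A :: "'a::ab_group_add mat"
  shows "A \<in> carrier_mat n n \<Longrightarrow> mat_trace (- A) = - mat_trace A"
  by (auto simp: mat_trace_def sum_negf)

lemma mat_trace_smult:
  fixes A :: "'a::semiring_0 mat"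
  shows "A \<in> carrier_mat n n \<Longrightarrow> mat_trace (c \<cdot>\<^sub>m A) = c * mat_trace A"
  by (auto simp: mat_trace_def sum_distrib_left)

lemma mat_trace_one: "mat_trace (1\<^sub>m n :: 'a::semiring_1 mat) = of_nat n"
  by (simp add: mat_trace_def)

section \<open>Derivatives of determinants and inverses of matrices\<close>

lemma fps_deriv_prod_sum:
  fixes f :: "'i \<Rightarrow> 'a::comm_ring_1 fps"
  assumes "finite A"
  shows "fps_deriv (prod f A) = (\<Sum>k\<in>A. fps_deriv (f k) * prod f (A - {k}))"
  using assms
proof (induction A rule: finite_induct)
  case (insert x A)
  have "(\<Sum>k\<in>A. fps_deriv (f k) * prod f (insert x A - {k}))
      = (\<Sum>k\<in>A. f x * (fps_deriv (f k) * prod f (A - {k})))"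
  proof (rule sum.cong)
    fix k assume "k \<in> A"
    then have "insert x A - {k} = insert x (A - {k})" using insert by auto
    then show "fps_deriv (f k) * prod f (insert x A - {k}) = f x * (fps_deriv (f k) * prod f (A - {k}))"
      using insert by (simp add: mult_ac)
  qed simp
  then show ?case
    using insert by (simp add: sum_distrib_left mult_ac)
qed simp

text \<open>The product rule in the Leibniz formula differentiates one row at a time;
  \<open>B k\<close> is \<open>A\<close> with row k differentiated. Expanding along that row gives
  the cofactors of \<open>A\<close>, which do not see the row.\<close>

lemma fps_deriv_det_cofactor:
  fixes A :: "'a::comm_ring_1 fps mat"
  assumes A: "A \<in> carrier_mat n n"
  shows "fps_deriv (det A) = (\<Sum>i<n. \<Sum>j<n. fps_deriv (A $$ (i, j)) * cofactor A i j)"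
proof -
  define B where "B k = mat n n (\<lambda>(i, j). if i = k then fps_deriv (A $$ (i, j)) else A $$ (i, j))" for k
  have B: "B k \<in> carrier_mat n n" for k by (simp add: B_def)
  have sg: "fps_deriv (signof p * f) = signof p * fps_deriv f" for p :: "nat \<Rightarrow> nat" and f :: "'a fps"
    by (auto simp: sign_def)
  have "fps_deriv (det A) = (\<Sum>p | p permutes {0..<n}. signof p *
      (\<Sum>k\<in>{0..<n}. fps_deriv (A $$ (k, p k)) * (\<Prod>i\<in>{0..<n} - {k}. A $$ (i, p i))))"
    unfolding det_def'[OF A] by (simp only: fps_deriv_sum sg fps_deriv_prod_sum[OF finite_atLeastLessThan])
  also have "\<dots> = (\<Sum>p | p permutes {0..<n}. signof p * (\<Sum>k\<in>{0..<n}. \<Prod>i\<in>{0..<n}. B k $$ (i, p i)))"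
  proof (intro sum.cong refl arg_cong2[of _ _ _ _ "(*)"])
    fix p k assume p: "p \<in> {p. p permutes {0..<n}}" and k: "k \<in> {0..<n}"
    then have pi: "p i < n" if "i < n" for i
      using that permutes_in_image[of p "{0..<n}" i] by auto
    have "(\<Prod>i\<in>{0..<n}. B k $$ (i, p i)) = B k $$ (k, p k) * (\<Prod>i\<in>{0..<n} - {k}. B k $$ (i, p i))"
      using k by (intro prod.remove) auto
    also have "(\<Prod>i\<in>{0..<n} - {k}. B k $$ (i, p i)) = (\<Prod>i\<in>{0..<n} - {k}. A $$ (i, p i))"
      by (intro prod.cong) (auto simp: B_def pi)
    also have "B k $$ (k, p k) = fps_deriv (A $$ (k, p k))" using k pi by (auto simp: B_def)
    finally show "fps_deriv (A $$ (k, p k)) * (\<Prod>i\<in>{0..<n} - {k}. A $$ (i, p i))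
        = (\<Prod>i\<in>{0..<n}. B k $$ (i, p i))" by simp
  qed
  also have "\<dots> = (\<Sum>k\<in>{0..<n}. det (B k))"
    unfolding det_def'[OF B] sum_distrib_left by (rule sum.swap)
  also have "\<dots> = (\<Sum>i<n. \<Sum>j<n. fps_deriv (A $$ (i, j)) * cofactor A i j)"
    unfolding atLeast0LessThan
  proof (intro sum.cong refl)
    fix k assume "k \<in> {..<n}"
    then have k: "k < n" by simp
    have "cofactor (B k) k j = cofactor A k j" for j
      unfolding cofactor_def using A k
      by (intro arg_cong2[of _ _ _ _ "\<lambda>x y. x * det y"]) (auto simp: B_def mat_delete_def)
    then show "det (B k) = (\<Sum>j<n. fps_deriv (A $$ (k, j)) * cofactor A k j)"
      using k unfolding laplace_expansion_row[OF B k] by (intro sum.cong) (auto simp: B_def)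
  qed
  finally show ?thesis .
qed

lemma adj_mat_eq_smult_left_inverse:
  fixes A B :: "'a::comm_ring_1 mat"
  assumes A: "A \<in> carrier_mat n n" and B: "B \<in> carrier_mat n n" and BA: "B * A = 1\<^sub>m n"
  shows "adj_mat A = det A \<cdot>\<^sub>m B"
proof -
  note adj = adj_mat[OF A]
  have "adj_mat A = (B * A) * adj_mat A" using adj(1) BA by simp
  also have "\<dots> = B * (det A \<cdot>\<^sub>m 1\<^sub>m n)" using A B adj by simp
  also have "\<dots> = det A \<cdot>\<^sub>m B" using B mult_smult_distrib[OF B one_carrier_mat, of "det A"] by simp
  finally show ?thesis .
qed

text \<open>Jacobi's formula: \<open>B\<close> times \<open>det A\<close> is the adjugate, so the
  cofactor sum becomes a trace.\<close>

lemma fps_deriv_det: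
  fixes A B :: "'a::comm_ring_1 fps mat"
  assumes A: "A \<in> carrier_mat n n" and B: "B \<in> carrier_mat n n" and BA: "B * A = 1\<^sub>m n"
  shows "fps_deriv (det A) = det A * mat_trace (B * map_mat fps_deriv A)"
proof -
  note adj = adj_mat[OF A]
  note eq = adj_mat_eq_smult_left_inverse[OF A B BA]
  have D: "map_mat fps_deriv A \<in> carrier_mat n n" using A by simp
  have "fps_deriv (det A) = mat_trace (adj_mat A * map_mat fps_deriv A)"
    unfolding mat_trace_mult[OF adj(1) D] fps_deriv_det_cofactor[OF A]
    using A by (subst sum.swap, intro sum.cong) (auto simp: adj_mat_def mult.commute)
  also have "\<dots> = mat_trace (det A \<cdot>\<^sub>m (B * map_mat fps_deriv A))"
    using B D by (simp add: eq mult_smult_assoc_mat[OF B D])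
  also have "\<dots> = det A * mat_trace (B * map_mat fps_deriv A)"
    by (rule mat_trace_smult[of _ n]) (use B D in auto)
  finally show ?thesis .
qed

text \<open>The adjugate is a two-sided inverse up to the factor \<open>det A\<close>, which is
  nonzero and can be cancelled in a domain.\<close>

lemma mat_left_inverse_imp_right:
  fixes A B :: "'a::idom mat"
  assumes A: "A \<in> carrier_mat n n" and B: "B \<in> carrier_mat n n" and BA: "B * A = 1\<^sub>m n"
  shows "A * B = 1\<^sub>m n"
proof -
  note adj = adj_mat[OF A]
  have eqn: "det A \<cdot>\<^sub>m (A * B) = det A \<cdot>\<^sub>m 1\<^sub>m n"
    using adj(2) by (simp add: adj_mat_eq_smult_left_inverse[OF A B BA] mult_smult_distrib[OF A B])
  have nz: "det A \<noteq> 0"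
    using det_mult[OF B A] BA by auto
  show ?thesis
  proof (rule eq_matI)
    fix i j assume "i < dim_row (1\<^sub>m n :: 'a mat)" "j < dim_col (1\<^sub>m n :: 'a mat)"
    then have ij: "i < n" "j < n" by auto
    have "(det A \<cdot>\<^sub>m (A * B)) $$ (i, j) = (det A \<cdot>\<^sub>m 1\<^sub>m n) $$ (i, j)" by (simp only: eqn)
    then have "det A * (A * B) $$ (i, j) = det A * 1\<^sub>m n $$ (i, j)"
      using ij A B by (simp del: index_mult_mat(1) index_one_mat(1))
    then show "(A * B) $$ (i, j) = 1\<^sub>m n $$ (i, j)" using nz by (simp only: mult_cancel_left) simp
  qed (use A B in auto)
qed

lemma det_fps_nth_0: "det A $ 0 = det (map_mat (\<lambda>f. f $ 0) A)"
  for A :: "'a::comm_ring_1 fps mat"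
proof -
  interpret comm_ring_hom "\<lambda>f :: 'a fps. f $ 0" by unfold_locales auto
  show ?thesis by simp
qed

text \<open>A power series over a field is a unit when its constant coefficient is nonzero, so the
  adjugate can be divided by the determinant.\<close>

lemma mat_fps_inverse_exists:
  fixes A :: "'a::field fps mat"
  assumes A: "A \<in> carrier_mat n n" and "det A $ 0 \<noteq> 0"
  obtains B where "B \<in> carrier_mat n n" "A * B = 1\<^sub>m n" "B * A = 1\<^sub>m n"
proof
  let ?B = "inverse (det A) \<cdot>\<^sub>m adj_mat A"
  note adj = adj_mat[OF A]
  show B: "?B \<in> carrier_mat n n" using adj by simp
  have "inverse (det A) * det A = 1" using assms(2) by (rule inverse_mult_eq_1)
  then show "?B * A = 1\<^sub>m n"
    using adj A by (auto simp: mult_smult_assoc_mat[OF adj(1) A] intro!: eq_matI simp flip: mult.assoc)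
  from mat_left_inverse_imp_right[OF A B this] show "A * ?B = 1\<^sub>m n" .
qed

lemma map_mat_fps_deriv_mult:
  fixes A B :: "'a::comm_ring_1 fps mat"
  assumes A: "A \<in> carrier_mat n k" and B: "B \<in> carrier_mat k m"
  shows "map_mat fps_deriv (A * B) = map_mat fps_deriv A * B + A * map_mat fps_deriv B"
proof (rule eq_matI)
  fix i j assume "i < dim_row (map_mat fps_deriv A * B + A * map_mat fps_deriv B)"
    "j < dim_col (map_mat fps_deriv A * B + A * map_mat fps_deriv B)"
  then have ij: "i < n" "j < m" using A B by auto
  have "map_mat fps_deriv (A * B) $$ (i, j) = fps_deriv ((A * B) $$ (i, j))"
    using ij A B by simp
  also have "\<dots> = (\<Sum>e<k. fps_deriv (A $$ (i, e)) * B $$ (e, j) + A $$ (i, e) * fps_deriv (B $$ (e, j)))"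
    by (simp add: mult_mat_entry[OF ij A B] fps_deriv_sum add.commute)
  also have "\<dots> = (map_mat fps_deriv A * B) $$ (i, j) + (A * map_mat fps_deriv B) $$ (i, j)"
    using A B ij by (simp add: mult_mat_entry[OF ij, of _ k] sum.distrib del: index_mult_mat)
  finally show "map_mat fps_deriv (A * B) $$ (i, j) =
      (map_mat fps_deriv A * B + A * map_mat fps_deriv B) $$ (i, j)"
    using A B ij by simp
qed (use A B in auto)

lemma fps_deriv_prod_log:
  fixes f :: "'i \<Rightarrow> 'a::comm_ring_1 fps"
  assumes "finite A" "\<And>x. x \<in> A \<Longrightarrow> fps_deriv (f x) = f x * t x"
  shows "fps_deriv (prod f A) = prod f A * sum t A"
  using assms by (induction A rule: finite_induct) (auto simp: algebra_simps)

text \<open>The coefficient at m + 1, multiplied by m + 1, is determined by the earlier ones;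
  characteristic 0 permits the division.\<close>

lemma fps_linear_ode_unique:
  fixes f g h :: "'a::field_char_0 fps"
  assumes "fps_deriv f = h * f" "fps_deriv g = h * g" "f $ 0 = g $ 0"
  shows "f = g"
proof -
  have "f $ n = g $ n" for n
  proof (induction n rule: less_induct)
    case (less n)
    show ?case
    proof (cases n)
      case 0
      then show ?thesis using assms by simp
    next
      case (Suc m)
      have "fps_deriv f $ m = fps_deriv g $ m"
        unfolding assms fps_mult_nth using less Suc by (intro sum.cong) auto
      then have "of_nat (Suc m) * f $ Suc m = of_nat (Suc m) * g $ Suc m" by simp
      then show ?thesis unfolding mult_cancel_left using Suc by (simp del: of_nat_Suc)
    qed
  qed
  then show ?thesis by (rule fps_ext)
qed

section \<open>Convolution, matrix powers and algebraicity of determinants\<close>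

text \<open>Any finite superset \<open>U\<close> of the support is allowed, so that one index set
  serves all entries of a matrix.\<close>

lemma lookup_mult_group:
  fixes p q :: "'f::group_add \<Rightarrow>\<^sub>0 'a::semiring_0"
  assumes "finite U" "Poly_Mapping.keys p \<subseteq> U"
  shows "Poly_Mapping.lookup (p * q) g =
    (\<Sum>u\<in>U. Poly_Mapping.lookup p u * Poly_Mapping.lookup q (- u + g))"
proof -
  have eq: "(g = u + v) \<longleftrightarrow> (v = - u + g)" for u v :: 'f
    by (metis add.assoc left_minus right_minus add_0)
  have "Poly_Mapping.lookup (p * q) g =
      (\<Sum>u. Poly_Mapping.lookup p u * Poly_Mapping.lookup q (- u + g))"
    unfolding lookup_mult eq by simp
  also have "\<dots> = (\<Sum>u\<in>U. Poly_Mapping.lookup p u * Poly_Mapping.lookup q (- u + g))"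
  proof (rule Sum_any.expand_superset[OF assms(1)])
    show "{a. Poly_Mapping.lookup p a * Poly_Mapping.lookup q (- a + g) \<noteq> 0} \<subseteq> U"
    proof
      fix a assume "a \<in> {a. Poly_Mapping.lookup p a * Poly_Mapping.lookup q (- a + g) \<noteq> 0}"
      then have "Poly_Mapping.lookup p a \<noteq> 0" by auto
      then show "a \<in> U" using assms(2) by (auto simp: in_keys_iff)
    qed
  qed
  finally show ?thesis .
qed

text \<open>Walks are decomposed by their first step, whereas \<open>pow_mat\<close> splits off the
  last factor.\<close>

lemma pow_mat_Suc_left:
  fixes M :: "'a::semiring_1 mat"
  assumes M: "M \<in> carrier_mat n n"
  shows "M ^\<^sub>m Suc k = M * M ^\<^sub>m k"
proof (induction k)
  case 0
  then show ?case using M by simp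
next
  case (Suc k)
  have "M ^\<^sub>m Suc (Suc k) = (M * M ^\<^sub>m k) * M" using Suc by simp
  also have "\<dots> = M * (M ^\<^sub>m k * M)"
    using M by (intro assoc_mult_mat) auto
  finally show ?case by simp
qed

lemma gen_ring_det:
  assumes "B \<in> carrier_mat n n" "\<And>i j. i < n \<Longrightarrow> j < n \<Longrightarrow> B $$ (i, j) \<in> gen_ring X"
  shows "det B \<in> gen_ring X"
  unfolding det_def'[OF assms(1)]
proof (intro gen_ring_sum gen_ring.mult gen_ring_prod)
  fix p i assume "p \<in> {p. p permutes {0..<n}}" and i: "i \<in> {0..<n}"
  then have "p i < n" using permutes_in_image[of p "{0..<n}" i] by auto
  with i show "B $$ (i, p i) \<in> gen_ring X" by (intro assms) auto
next
  fix p :: "nat \<Rightarrow> nat"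
  show "signof p \<in> gen_ring X"
    by (auto simp: sign_def intro: gen_ring.one gen_ring.uminus)
qed

text \<open>An equation p(Y) = 0 for t^m f yields the equation p(t^m Y) = 0 for f.\<close>

lemma fps_algebraic_X_power_cancel:
  fixes f :: "'a::idom fps"
  assumes "fps_algebraic (fps_X ^ m * f)"
  shows "fps_algebraic f"
proof -
  from assms obtain p where p: "p \<noteq> 0" "poly (map_poly fps_of_poly p) (fps_X ^ m * f) = 0"
    by (auto simp: fps_algebraic_def)
  interpret h: comm_ring_hom "fps_of_poly :: 'a poly \<Rightarrow> 'a fps"
    by (rule comm_ring_hom_fps_of_poly)
  let ?p = "pcompose p [:0, monom 1 m:]"
  have "?p \<noteq> 0" using p(1) by (simp add: pcompose_eq_0_iff)
  moreover have "poly (map_poly fps_of_poly ?p) f = 0"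
    using p(2) by (simp add: h.map_poly_pcompose poly_pcompose h.map_poly_pCons_hom fps_of_poly_monom' mult.commute)
  ultimately show ?thesis by (auto simp: fps_algebraic_def)
qed

section \<open>Matrices supported on the letters of a free group\<close>

text \<open>Letters are identified with their values in the group, and \<open>nf g\<close> is the reduced word of \<open>g\<close>.\<close>

locale tree_group =
  fixes S :: "'f::group_add set" and nf :: "'f \<Rightarrow> 'f list"
  assumes finite_S: "finite S"
    and S_disj: "x \<in> S \<Longrightarrow> - x \<notin> S"
    and nf_0: "nf 0 = []"
    and nf_set: "set (nf g) \<subseteq> S \<union> uminus ` S"
    and nf_sum: "sum_list (nf g) = g"
    and nf_extend: "x \<in> S \<union> uminus ` S \<Longrightarrow> (\<And>w. nf g \<noteq> (- x) # w) \<Longrightarrow> nf (x + g) = x # nf g"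
    and nf_tail: "nf g = x # w \<Longrightarrow> nf (- x + g) = w"
begin

definition letters :: "'f set" where "letters = S \<union> uminus ` S"

lemma finite_letters: "finite letters"
  using finite_S by (simp add: letters_def)

lemma uminus_letters: "x \<in> letters \<Longrightarrow> - x \<in> letters"
  by (auto simp: letters_def)

lemma zero_not_letter: "0 \<notin> letters"
  using S_disj[of 0] by (auto simp: letters_def)

lemma sum_letters_split: "sum f letters = (\<Sum>x\<in>S. f x + f (- x))"
  for f :: "'f \<Rightarrow> 'b::comm_monoid_add"
proof -
  have "S \<inter> uminus ` S = {}" using S_disj by fastforce
  then have "sum f letters = sum f S + sum f (uminus ` S)"
    using finite_S by (simp add: letters_def sum.union_disjoint)
  also have "sum f (uminus ` S) = (\<Sum>x\<in>S. f (- x))"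
    by (subst sum.reindex) (auto simp: inj_on_def)
  finally show ?thesis by (simp add: sum.distrib)
qed

lemma sum_letters_uminus: "(\<Sum>x\<in>letters. f (- x)) = sum f letters"
  for f :: "'f \<Rightarrow> 'b::comm_monoid_add"
  unfolding sum_letters_split by (simp add: add.commute)

end

section \<open>First-passage matrices and their quadratic system\<close>

text \<open>The support condition says that a step of the matrix-weighted walk stays put or crosses
  one edge of the Cayley tree.\<close>

locale tree_matrix = tree_group S nf for S :: "'f::group_add set" and nf +
  fixes M :: "('f \<Rightarrow>\<^sub>0 rat) mat" and d :: nat
  assumes M: "M \<in> carrier_mat d d"
    and keys_M: "\<And>i j. i < d \<Longrightarrow> j < d \<Longrightarrow> Poly_Mapping.keys (M $$ (i, j)) \<subseteq> insert 0 letters"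
begin

definition a :: "'f \<Rightarrow> nat \<Rightarrow> nat \<Rightarrow> rat" where
  "a u i j = Poly_Mapping.lookup (M $$ (i, j)) u"

definition A :: "'f \<Rightarrow> rat fps mat" where
  "A u = mat d d (\<lambda>(i, j). fps_const (a u i j))"

definition idx :: "('f \<times> nat \<times> nat) set" where
  "idx = insert 0 letters \<times> {..<d} \<times> {..<d}"

text \<open>
  The coefficients encode \<open>F\<^sub>x = t (A\<^sub>x + A\<^sub>0 F\<^sub>x + \<Sum>\<^sub>v A\<^sub>-\<^sub>v F\<^sub>v F\<^sub>x)\<close>, the sum being over letters
  \<open>v \<noteq> - x\<close> (a walk to \<open>x\<close> that starts elsewhere must first return). The index \<open>x = 0\<close>, which is not a
  letter, is used for \<open>F\<^sub>0 = t G\<close>; there the inhomogeneous term is \<open>1\<close> instead of \<open>A\<^sub>0\<close>.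
\<close>

definition qc :: "'f \<times> nat \<times> nat \<Rightarrow> rat" where
  "qc = (\<lambda>(x, i, j). if x = 0 then (if i = j then 1 else 0) else a x i j)"

definition ql :: "'f \<times> nat \<times> nat \<Rightarrow> 'f \<times> nat \<times> nat \<Rightarrow> rat" where
  "ql = (\<lambda>(x, i, j) (x', k, j'). if x' = x then if j' = j then a 0 i k else 0 else 0)"

definition qq :: "'f \<times> nat \<times> nat \<Rightarrow> 'f \<times> nat \<times> nat \<Rightarrow> 'f \<times> nat \<times> nat \<Rightarrow> rat" where
  "qq = (\<lambda>(x, i, j) (v, e, k') (x', k, j').
     if x' = x then if j' = j then if k = k' then
       (if v \<in> letters - {- x} then a (- v) i e else 0) else 0 else 0 else 0)"

definition y :: "'f \<times> nat \<times> nat \<Rightarrow> rat fps" where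
  "y = (SOME y. (\<lambda>i. if i \<in> idx then fps_X * quad_map idx qc ql qq 0 y i else 0) = y)"

lemma y_quad_system: "i \<in> idx \<Longrightarrow> y i = fps_X * quad_map idx qc ql qq 0 y i"
proof -
  assume i: "i \<in> idx"
  have "(\<lambda>i. if i \<in> idx then fps_X * quad_map idx qc ql qq 0 y i else 0) = y"
    unfolding y_def by (rule someI_ex[OF ex1_implies_ex[OF quad_system_ex1]])
  from fun_cong[OF this, of i] show ?thesis by (simp only: i if_True)
qed

lemma sum_idx: "sum f idx = (\<Sum>x\<in>insert 0 letters. \<Sum>i<d. \<Sum>j<d. f (x, i, j))"
  for f :: "_ \<Rightarrow> 'b::comm_monoid_add"
  by (simp add: idx_def sum.cartesian_product case_prod_beta del: sum.insert_if sum.insert)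

text \<open>The Kronecker deltas in \<open>ql\<close> and \<open>qq\<close> collapse the sums over
  \<open>idx\<close> to entries of matrix products.\<close>

lemma y_eq:
  assumes x: "x \<in> insert 0 letters" and ij: "i < d" "j < d"
  shows "y (x, i, j) = fps_X * (fps_const (qc (x, i, j)) + (\<Sum>k<d. fps_const (a 0 i k) * y (x, k, j))
    + (\<Sum>k<d. (\<Sum>v\<in>letters - {- x}. \<Sum>e<d. fps_const (a (- v) i e) * y (v, e, k)) * y (x, k, j)))"
proof -
  have fin: "finite (insert 0 letters)" using finite_letters by simp
  have push: "fps_const (if P then r else 0) * z = (if P then fps_const r * z else 0)"
    for P and r :: rat and z by simp
  have "(\<Sum>j'\<in>idx. fps_const (ql (x, i, j) j') * y j') = (\<Sum>k<d. fps_const (a 0 i k) * y (x, k, j))"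
  proof -
    have "(\<Sum>j'\<in>idx. fps_const (ql (x, i, j) j') * y j')
        = (\<Sum>x'\<in>insert 0 letters. \<Sum>k<d. \<Sum>j'<d.
            fps_const (ql (x, i, j) (x', k, j')) * y (x', k, j'))"
      by (rule sum_idx)
    also have "\<dots> = (\<Sum>x'\<in>insert 0 letters. if x' = x then
        (\<Sum>k<d. fps_const (a 0 i k) * y (x, k, j)) else 0)"
      using ij by (intro sum.cong refl) (simp add: ql_def push del: sum.insert_if sum.insert)
    also have "\<dots> = (\<Sum>k<d. fps_const (a 0 i k) * y (x, k, j))"
      using fin x by (simp add: sum.delta del: sum.insert_if sum.insert)
    finally show ?thesis .
  qed
  moreover have "(\<Sum>u\<in>idx. \<Sum>j'\<in>idx. fps_const (qq (x, i, j) u j') * (y u * y j'))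
      = (\<Sum>k<d. (\<Sum>v\<in>letters - {- x}. \<Sum>e<d. fps_const (a (- v) i e) * y (v, e, k)) * y (x, k, j))"
  proof -
    have inner: "(\<Sum>j'\<in>idx. fps_const (qq (x, i, j) (v, e, k') j') * (y (v, e, k') * y j'))
        = (if v \<in> letters - {- x} then fps_const (a (- v) i e) * y (v, e, k') * y (x, k', j) else 0)"
      if "k' < d" for v e k'
    proof -
      have "(\<Sum>j'\<in>idx. fps_const (qq (x, i, j) (v, e, k') j') * (y (v, e, k') * y j'))
        = (\<Sum>x'\<in>insert 0 letters. \<Sum>k<d. \<Sum>j'<d.
            fps_const (qq (x, i, j) (v, e, k') (x', k, j')) * (y (v, e, k') * y (x', k, j')))"
        by (rule sum_idx)
      also have "\<dots> = (\<Sum>x'\<in>insert 0 letters. if x' = x then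
          (if v \<in> letters - {- x} then fps_const (a (- v) i e) * y (v, e, k') * y (x, k', j) else 0) else 0)"
        using ij that by (intro sum.cong refl) (simp add: qq_def push mult.assoc del: sum.insert_if sum.insert)
      also have "\<dots> = (if v \<in> letters - {- x} then fps_const (a (- v) i e) * y (v, e, k') * y (x, k', j) else 0)"
        using fin x by (simp add: sum.delta del: sum.insert_if sum.insert)
      finally show ?thesis .
    qed
    have "(\<Sum>u\<in>idx. \<Sum>j'\<in>idx. fps_const (qq (x, i, j) u j') * (y u * y j'))
        = (\<Sum>v\<in>insert 0 letters. \<Sum>e<d. \<Sum>k<d. \<Sum>j'\<in>idx.
            fps_const (qq (x, i, j) (v, e, k) j') * (y (v, e, k) * y j'))"
      by (rule sum_idx)
    also have "\<dots> = (\<Sum>v\<in>insert 0 letters. \<Sum>e<d. \<Sum>k<d.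
        (if v \<in> letters - {- x} then fps_const (a (- v) i e) * y (v, e, k) * y (x, k, j) else 0))"
      by (intro sum.cong refl inner) simp
    also have "\<dots> = (\<Sum>v\<in>letters - {- x}. \<Sum>e<d. \<Sum>k<d.
        fps_const (a (- v) i e) * y (v, e, k) * y (x, k, j))"
      by (rule sum.mono_neutral_cong_right) (use fin zero_not_letter in auto)
    also have "\<dots> = (\<Sum>k<d. \<Sum>v\<in>letters - {- x}. \<Sum>e<d.
        fps_const (a (- v) i e) * y (v, e, k) * y (x, k, j))"
      by (subst (2) sum.swap, subst sum.swap) simp
    finally show ?thesis by (simp add: sum_distrib_right)
  qed
  moreover have "(x, i, j) \<in> idx" using x ij by (simp add: idx_def)
  ultimately show ?thesis
    using y_quad_system[of "(x, i, j)"] by (simp add: quad_map_def)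
qed

definition F :: "'f \<Rightarrow> rat fps mat" where
  "F x = mat d d (\<lambda>(i, j). y (x, i, j))"

text \<open>One step that either stays or goes to some - v other than x, followed by the first
  return. For x = 0 nothing is excluded, since 0 is not a letter.\<close>

definition V :: "'f \<Rightarrow> rat fps mat" where
  "V x = mat d d (\<lambda>(i, k). fps_const (a 0 i k) + (\<Sum>v\<in>letters - {- x}. (A (- v) * F v) $$ (i, k)))"

text \<open>The shift divides by t, as the index 0 of the system carries t G.\<close>

definition G :: "rat fps mat" where
  "G = mat d d (\<lambda>(i, j). fps_shift 1 (y (0, i, j)))"

lemma carriers [simp]:
  "A u \<in> carrier_mat d d" "F u \<in> carrier_mat d d" "V u \<in> carrier_mat d d" "G \<in> carrier_mat d d"
  by (auto simp: A_def F_def V_def G_def)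

lemma dims [simp]:
  "dim_row (A u) = d" "dim_col (A u) = d" "dim_row (F u) = d" "dim_col (F u) = d"
  "dim_row (V u) = d" "dim_col (V u) = d" "dim_row G = d" "dim_col G = d"
  by (auto simp: A_def F_def V_def G_def)

lemma A_entry: "i < d \<Longrightarrow> j < d \<Longrightarrow> A u $$ (i, j) = fps_const (a u i j)"
  and F_entry: "i < d \<Longrightarrow> j < d \<Longrightarrow> F u $$ (i, j) = y (u, i, j)"
  and V_entry: "i < d \<Longrightarrow> j < d \<Longrightarrow> V u $$ (i, j) =
    fps_const (a 0 i j) + (\<Sum>v\<in>letters - {- u}. (A (- v) * F v) $$ (i, j))"
  by (simp_all add: A_def F_def V_def del: index_mult_mat(1))

text \<open>The product is regrouped so that \<open>F v * B\<close> appears; with \<open>B\<close> =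
  \<open>H g\<close> this factor becomes \<open>H (v + g)\<close>.\<close>

lemma V_mult_entry:
  assumes B: "B \<in> carrier_mat d d" and ij: "i < d" "j < d"
  shows "(V x * B) $$ (i, j) = (\<Sum>k<d. fps_const (a 0 i k) * B $$ (k, j))
    + (\<Sum>v\<in>letters - {- x}. \<Sum>k<d. fps_const (a (- v) i k) * (F v * B) $$ (k, j))"
proof -
  have "(V x * B) $$ (i, j) = (\<Sum>k<d. V x $$ (i, k) * B $$ (k, j))"
    using ij B by (intro mult_mat_entry) auto
  also have "\<dots> = (\<Sum>k<d. fps_const (a 0 i k) * B $$ (k, j))
      + (\<Sum>k<d. \<Sum>v\<in>letters - {- x}. (A (- v) * F v) $$ (i, k) * B $$ (k, j))"
    using ij by (simp add: V_entry distrib_right sum.distrib sum_distrib_right del: index_mult_mat(1))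
  also have "(\<Sum>k<d. \<Sum>v\<in>letters - {- x}. (A (- v) * F v) $$ (i, k) * B $$ (k, j))
      = (\<Sum>v\<in>letters - {- x}. \<Sum>k<d. (A (- v) * F v) $$ (i, k) * B $$ (k, j))"
    by (rule sum.swap)
  also have "\<dots> = (\<Sum>v\<in>letters - {- x}. \<Sum>k<d. fps_const (a (- v) i k) * (F v * B) $$ (k, j))"
  proof (rule sum.cong[OF refl])
    fix v
    have "(\<Sum>k<d. (A (- v) * F v) $$ (i, k) * B $$ (k, j)) = ((A (- v) * F v) * B) $$ (i, j)"
      by (rule mult_mat_entry[OF ij mult_carrier_mat[OF carriers(1,2)] B, symmetric])
    also have "(A (- v) * F v) * B = A (- v) * (F v * B)"
      using B by (intro assoc_mult_mat) auto
    also have "\<dots> $$ (i, j) = (\<Sum>k<d. A (- v) $$ (i, k) * (F v * B) $$ (k, j))"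
      using ij B by (intro mult_mat_entry) auto
    finally show "(\<Sum>k<d. (A (- v) * F v) $$ (i, k) * B $$ (k, j))
        = (\<Sum>k<d. fps_const (a (- v) i k) * (F v * B) $$ (k, j))"
      using ij by (simp add: A_entry del: index_mult_mat(1))
  qed
  finally show ?thesis .
qed

lemma F_eq:
  assumes "x \<in> insert 0 letters"
  shows "F x = fps_X \<cdot>\<^sub>m ((if x = 0 then 1\<^sub>m d else A x) + V x * F x)"
proof (rule eq_matI)
  fix i j
  assume "i < dim_row (fps_X \<cdot>\<^sub>m ((if x = 0 then 1\<^sub>m d else A x) + V x * F x))"
    "j < dim_col (fps_X \<cdot>\<^sub>m ((if x = 0 then 1\<^sub>m d else A x) + V x * F x))"
  then have ij: "i < d" "j < d" by auto
  have "(V x * F x) $$ (i, j) = (\<Sum>k<d. fps_const (a 0 i k) * y (x, k, j))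
    + (\<Sum>k<d. (\<Sum>v\<in>letters - {- x}. \<Sum>e<d. fps_const (a (- v) i e) * y (v, e, k)) * y (x, k, j))"
    using ij
    by (simp add: mult_mat_entry[of _ d _ d _ d] V_entry F_entry A_entry distrib_right sum.distrib
        del: index_mult_mat(1))
  moreover have "(if x = 0 then 1\<^sub>m d else A x) $$ (i, j) = fps_const (qc (x, i, j))"
    using ij by (simp add: qc_def A_entry)
  ultimately show "F x $$ (i, j) = (fps_X \<cdot>\<^sub>m ((if x = 0 then 1\<^sub>m d else A x) + V x * F x)) $$ (i, j)"
    using ij y_eq[OF assms ij] by (simp add: F_entry add.assoc del: index_mult_mat(1))
qed auto

lemma F_letter_eq: "x \<in> letters \<Longrightarrow> F x = fps_X \<cdot>\<^sub>m (A x + V x * F x)"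
  by (subst F_eq) (use zero_not_letter in auto)

lemma y_nth_0: "x \<in> insert 0 letters \<Longrightarrow> i < d \<Longrightarrow> j < d \<Longrightarrow> y (x, i, j) $ 0 = 0"
  using y_eq[of x i j] by simp

lemma F_0_eq: "F 0 = fps_X \<cdot>\<^sub>m G"
proof (rule eq_matI)
  fix i j assume "i < dim_row (fps_X \<cdot>\<^sub>m G)" "j < dim_col (fps_X \<cdot>\<^sub>m G)"
  then have ij: "i < d" "j < d" by auto
  have "f = fps_X * fps_shift 1 f" if "f $ 0 = 0" for f :: "rat fps"
    by (rule fps_ext) (use that in \<open>simp split: nat.split\<close>)
  with y_nth_0[of 0] ij show "F 0 $$ (i, j) = (fps_X \<cdot>\<^sub>m G) $$ (i, j)"
    by (simp add: F_entry G_def)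
qed auto

lemma G_eq: "G = 1\<^sub>m d + fps_X \<cdot>\<^sub>m (V 0 * G)"
proof (rule eq_matI)
  fix i j assume "i < dim_row (1\<^sub>m d + fps_X \<cdot>\<^sub>m (V 0 * G))" "j < dim_col (1\<^sub>m d + fps_X \<cdot>\<^sub>m (V 0 * G))"
  then have ij: "i < d" "j < d" by auto
  have "fps_X \<cdot>\<^sub>m G = fps_X \<cdot>\<^sub>m (1\<^sub>m d + V 0 * (fps_X \<cdot>\<^sub>m G))"
    by (subst (1 2) F_0_eq[symmetric], subst F_eq) simp_all
  then have "(fps_X \<cdot>\<^sub>m G) $$ (i, j) = (fps_X \<cdot>\<^sub>m (1\<^sub>m d + fps_X \<cdot>\<^sub>m (V 0 * G))) $$ (i, j)"
    by (simp only: mult_smult_distrib[OF carriers(3,4)])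
  then have "fps_X * G $$ (i, j) = fps_X * (1\<^sub>m d + fps_X \<cdot>\<^sub>m (V 0 * G)) $$ (i, j)"
    using ij by (simp del: index_mult_mat(1))
  then show "G $$ (i, j) = (1\<^sub>m d + fps_X \<cdot>\<^sub>m (V 0 * G)) $$ (i, j)"
    by (simp only: mult_cancel_left fps_X_neq_zero simp_thms)
qed auto

section \<open>Coefficients of the resolvent\<close>

text \<open>A walk from the identity to g must visit the prefixes of the reduced word in turn; after
  the last first passage, a closed walk remains.\<close>

definition H :: "'f \<Rightarrow> rat fps mat" where
  "H g = foldr (\<lambda>x B. F x * B) (nf g) G"

lemma H_carrier [simp]: "H g \<in> carrier_mat d d"
proof -
  have "foldr (\<lambda>x B. F x * B) w G \<in> carrier_mat d d" for w
    by (induction w) (auto intro: mult_carrier_mat)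
  then show ?thesis by (simp add: H_def)
qed

lemma H_extend: "x \<in> letters \<Longrightarrow> (\<And>w. nf g \<noteq> (- x) # w) \<Longrightarrow> H (x + g) = F x * H g"
  using nf_extend[of x g] by (simp add: H_def letters_def)

text \<open>This is the first-step equation for the coefficient of (1 - t M)^(-1) at g: after the
  step - v, a displacement v + g is left. For g = 0 it is the equation of \<open>G\<close>. If g
  begins with x, then v = - x shortens the word and meets the term \<open>A x\<close> of the
  equation of \<open>F x\<close>, while every other v lengthens it.\<close>

lemma H_rec:
  assumes ij: "i < d" "j < d"
  shows "H g $$ (i, j) = (if g = 0 \<and> i = j then 1 else 0)
    + fps_X * ((\<Sum>k<d. fps_const (a 0 i k) * H g $$ (k, j))
      + (\<Sum>v\<in>letters. \<Sum>k<d. fps_const (a (- v) i k) * H (v + g) $$ (k, j)))"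
proof (cases "nf g")
  case Nil
  then have g: "g = 0" using nf_sum[of g] by simp
  have H0: "H 0 = G" by (simp add: H_def nf_0)
  have Hv: "H v = F v * G" if "v \<in> letters" for v
    using H_extend[OF that, of 0] by (simp add: H0 nf_0)
  have "letters - {- 0} = letters" using zero_not_letter by simp
  then have "(V 0 * G) $$ (i, j) = (\<Sum>k<d. fps_const (a 0 i k) * H 0 $$ (k, j))
      + (\<Sum>v\<in>letters. \<Sum>k<d. fps_const (a (- v) i k) * H v $$ (k, j))"
    using V_mult_entry[OF carriers(4) ij, of 0] by (simp add: H0 Hv del: index_mult_mat(1))
  moreover have "G $$ (i, j) = (1\<^sub>m d + fps_X \<cdot>\<^sub>m (V 0 * G)) $$ (i, j)"
    by (subst G_eq) simp
  ultimately show ?thesis using ij by (simp add: g H0 del: index_mult_mat(1))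
next
  case (Cons x w)
  have x: "x \<in> letters" using nf_set[of g] Cons by (auto simp: letters_def)
  have g: "g \<noteq> 0" using Cons nf_0 by auto
  have x0: "x \<noteq> 0" using x zero_not_letter by auto
  let ?K = "H (- x + g)"
  have Hg: "H g = F x * ?K" using nf_tail[OF Cons] by (simp add: H_def Cons)
  have Hv: "H (v + g) = F v * H g" if "v \<in> letters - {- x}" for v
    using that Cons by (intro H_extend) auto
  have "H g = (fps_X \<cdot>\<^sub>m (A x + V x * F x)) * ?K"
    unfolding Hg by (subst F_letter_eq[OF x]) simp
  also have "\<dots> = fps_X \<cdot>\<^sub>m (A x * ?K + V x * H g)"
  proof -
    have "(A x + V x * F x) * ?K = A x * ?K + (V x * F x) * ?K"
      by (rule add_mult_distrib_mat[of _ d d _ _ d]) auto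
    moreover have "(V x * F x) * ?K = V x * (F x * ?K)"
      by (rule assoc_mult_mat[of _ d d _ d _ d]) auto
    ultimately show ?thesis
      by (subst mult_smult_assoc_mat[of _ d d _ d]) (auto simp: Hg)
  qed
  finally have "H g $$ (i, j) = (fps_X \<cdot>\<^sub>m (A x * ?K + V x * H g)) $$ (i, j)"
    by (rule arg_cong)
  also have "\<dots> = fps_X * ((A x * ?K) $$ (i, j) + (V x * H g) $$ (i, j))"
    using ij carrier_matD[OF H_carrier] by (simp del: index_mult_mat(1))
  also have "(A x * ?K) $$ (i, j) = (\<Sum>k<d. fps_const (a x i k) * ?K $$ (k, j))"
    using ij by (subst mult_mat_entry[of _ d _ d _ d]) (auto simp: A_entry)
  also have "(V x * H g) $$ (i, j) = (\<Sum>k<d. fps_const (a 0 i k) * H g $$ (k, j))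
      + (\<Sum>v\<in>letters - {- x}. \<Sum>k<d. fps_const (a (- v) i k) * H (v + g) $$ (k, j))"
    unfolding V_mult_entry[OF H_carrier ij] by (simp add: Hv del: index_mult_mat(1))
  finally have "H g $$ (i, j) = fps_X * ((\<Sum>k<d. fps_const (a x i k) * ?K $$ (k, j))
      + ((\<Sum>k<d. fps_const (a 0 i k) * H g $$ (k, j))
      + (\<Sum>v\<in>letters - {- x}. \<Sum>k<d. fps_const (a (- v) i k) * H (v + g) $$ (k, j))))" .
  then show ?thesis
    using g sum.remove[OF finite_letters uminus_letters[OF x],
        of "\<lambda>v. \<Sum>k<d. fps_const (a (- v) i k) * H (v + g) $$ (k, j)"]
    by (simp add: add_ac)
qed

text \<open>Both sides have the same value at n = 0 and satisfy the same recursion in n, by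
  splitting off the first step.\<close>

lemma lookup_power_eq_H:
  assumes "i < d" "j < d"
  shows "Poly_Mapping.lookup ((M ^\<^sub>m n) $$ (i, j)) g = H g $$ (i, j) $ n"
  using assms
proof (induction n arbitrary: i j g)
  case 0
  then show ?case
    using M by (subst H_rec) (auto simp: lookup_one when_def lookup_zero)
next
  case (Suc n)
  have "Poly_Mapping.lookup ((M ^\<^sub>m Suc n) $$ (i, j)) g
      = Poly_Mapping.lookup (\<Sum>k<d. M $$ (i, k) * (M ^\<^sub>m n) $$ (k, j)) g"
    unfolding pow_mat_Suc_left[OF M]
    using Suc.prems M by (subst mult_mat_entry[of _ d _ d _ d]) auto
  also have "\<dots> = (\<Sum>k<d. Poly_Mapping.lookup (M $$ (i, k) * (M ^\<^sub>m n) $$ (k, j)) g)"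
    by (rule lookup_sum)
  also have "\<dots> = (\<Sum>k<d. \<Sum>u\<in>insert 0 letters. a u i k * H (- u + g) $$ (k, j) $ n)"
    using Suc finite_letters
    by (intro sum.cong refl)
       (simp add: lookup_mult_group[OF _ keys_M] a_def del: sum.insert_if sum.insert)
  also have "\<dots> = (\<Sum>k<d. a 0 i k * H g $$ (k, j) $ n)
      + (\<Sum>u\<in>letters. \<Sum>k<d. a u i k * H (- u + g) $$ (k, j) $ n)"
    using zero_not_letter finite_letters by (simp add: sum.distrib) (rule sum.swap)
  also have "(\<Sum>u\<in>letters. \<Sum>k<d. a u i k * H (- u + g) $$ (k, j) $ n)
      = (\<Sum>v\<in>letters. \<Sum>k<d. a (- v) i k * H (v + g) $$ (k, j) $ n)"
    using sum_letters_uminus[of "\<lambda>u. \<Sum>k<d. a u i k * H (- u + g) $$ (k, j) $ n"] by simp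
  finally show ?case
    using Suc.prems by (subst H_rec) (simp_all add: fps_sum_nth)
qed

lemma zeta_coeff_eq: "zeta_coeff M n = mat_trace G $ n"
proof -
  have "dim_row (M ^\<^sub>m n) = d" using M by (metis carrier_matD(1) pow_carrier_mat)
  moreover have "H 0 = G" by (simp add: H_def nf_0)
  ultimately show ?thesis
    by (simp add: zeta_coeff_def mat_trace_def lookup_sum lookup_power_eq_H fps_sum_nth)
qed

lemma square_carriers [simp]:
  fixes X Y :: "rat fps mat"
  assumes "X \<in> carrier_mat d d" "Y \<in> carrier_mat d d"
  shows "X * Y \<in> carrier_mat d d" "X + Y \<in> carrier_mat d d" "X - Y \<in> carrier_mat d d"
  using assms by auto

section \<open>Logarithmic derivatives of the determinants\<close>

text \<open>By \<open>G_eq\<close> this is the inverse of \<open>G\<close>.\<close>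

definition W :: "rat fps mat" where "W = 1\<^sub>m d - fps_X \<cdot>\<^sub>m V 0"

definition C :: "'f \<Rightarrow> rat fps mat" where "C u = 1\<^sub>m d - F (- u) * F u"

text \<open>The inverse of \<open>C u\<close>; it exists for letters, where \<open>det (C u)\<close>
  has constant coefficient 1.\<close>

definition E :: "'f \<Rightarrow> rat fps mat" where
  "E u = (SOME B. B \<in> carrier_mat d d \<and> C u * B = 1\<^sub>m d \<and> B * C u = 1\<^sub>m d)"

text \<open>Up to sign, \<open>T x\<close> and \<open>T (- x)\<close> are the two parts of the
  logarithmic derivative of det (1 - F_x F_-x), one for each differentiated factor.\<close>

definition T :: "'f \<Rightarrow> rat fps" where
  "T u = mat_trace (F (- u) * E (- u) * map_mat fps_deriv (F u))"

lemma W_carrier [simp]: "W \<in> carrier_mat d d" and C_carrier [simp]: "C u \<in> carrier_mat d d"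
  by (auto simp: W_def C_def)

lemma W_G: "W * G = 1\<^sub>m d"
proof -
  have "W * G = G - fps_X \<cdot>\<^sub>m (V 0 * G)"
    unfolding W_def by (simp add: minus_mult_distrib_mat[of _ d d _ _ d] mult_smult_assoc_mat[of _ d d _ d])
  also have "\<dots> = (1\<^sub>m d + fps_X \<cdot>\<^sub>m (V 0 * G)) - fps_X \<cdot>\<^sub>m (V 0 * G)"
    by (subst (1) G_eq) simp
  also have "\<dots> = 1\<^sub>m d"
    by (rule eq_matI) (auto simp del: index_mult_mat(1))
  finally show ?thesis .
qed

lemma G_W: "G * W = 1\<^sub>m d"
  by (rule mat_left_inverse_imp_right[OF _ _ W_G]) auto

lemma V_0_eq: "u \<in> letters \<Longrightarrow> V 0 = V u + A u * F (- u)"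
proof (rule eq_matI)
  fix i j assume u: "u \<in> letters" and "i < dim_row (V u + A u * F (- u))" "j < dim_col (V u + A u * F (- u))"
  then have ij: "i < d" "j < d" by auto
  have "letters - {- 0} = letters" using zero_not_letter by simp
  then show "V 0 $$ (i, j) = (V u + A u * F (- u)) $$ (i, j)"
    using ij sum.remove[OF finite_letters uminus_letters[OF u], of "\<lambda>v. (A (- v) * F v) $$ (i, j)"]
    by (simp add: V_entry add_ac del: index_mult_mat(1))
qed auto

text \<open>Completing \<open>V u\<close> to \<open>V 0\<close> in the equation of
  \<open>F u\<close> introduces the factor 1 - F_-u F_u.\<close>

lemma W_F:
  assumes u: "u \<in> letters"
  shows "W * F u = fps_X \<cdot>\<^sub>m (A u * C u)"
proof -
  have "W * F u = F u - fps_X \<cdot>\<^sub>m (V 0 * F u)"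
    unfolding W_def by (simp add: minus_mult_distrib_mat[of _ d d _ _ d] mult_smult_assoc_mat[of _ d d _ d])
  also have "V 0 * F u = V u * F u + A u * (F (- u) * F u)"
    unfolding V_0_eq[OF u]
    by (simp add: add_mult_distrib_mat[of _ d d _ _ d] assoc_mult_mat[of _ d d _ d _ d])
  also have "F u - fps_X \<cdot>\<^sub>m (V u * F u + A u * (F (- u) * F u))
      = fps_X \<cdot>\<^sub>m (A u + V u * F u) - fps_X \<cdot>\<^sub>m (V u * F u + A u * (F (- u) * F u))"
    by (subst (1) F_letter_eq[OF u]) simp
  also have "\<dots> = fps_X \<cdot>\<^sub>m (A u - A u * (F (- u) * F u))"
    by (rule eq_matI) (auto simp: algebra_simps simp del: index_mult_mat(1))
  also have "A u - A u * (F (- u) * F u) = A u * C u"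
    unfolding C_def by (simp add: mult_minus_distrib_mat[of _ d d _ d])
  finally show ?thesis .
qed

lemma det_C_nth_0:
  assumes u: "u \<in> letters"
  shows "det (C u) $ 0 = 1"
proof -
  have "map_mat (\<lambda>f. f $ 0) (C u) = 1\<^sub>m d"
  proof (rule eq_matI)
    fix i j assume "i < dim_row (1\<^sub>m d :: rat mat)" "j < dim_col (1\<^sub>m d :: rat mat)"
    then have ij: "i < d" "j < d" by auto
    have "(F (- u) * F u) $$ (i, j) $ 0 = 0"
      using ij u by (simp add: mult_mat_entry[of _ d _ d _ d] F_entry fps_sum_nth y_nth_0 del: index_mult_mat(1))
    then show "map_mat (\<lambda>f. f $ 0) (C u) $$ (i, j) = 1\<^sub>m d $$ (i, j)"
      using ij by (simp add: C_def del: index_mult_mat(1))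
  qed (auto simp: C_def)
  then show ?thesis by (simp add: det_fps_nth_0)
qed

lemma E_props:
  assumes "u \<in> letters"
  shows "E u \<in> carrier_mat d d" "C u * E u = 1\<^sub>m d" "E u * C u = 1\<^sub>m d"
proof -
  have "\<exists>B. B \<in> carrier_mat d d \<and> C u * B = 1\<^sub>m d \<and> B * C u = 1\<^sub>m d"
    using mat_fps_inverse_exists[of "C u" d] det_C_nth_0[OF assms] by (metis C_carrier one_neq_zero)
  from someI_ex[OF this]
  show "E u \<in> carrier_mat d d" "C u * E u = 1\<^sub>m d" "E u * C u = 1\<^sub>m d"
    unfolding E_def by auto
qed

text \<open>Multiplying \<open>W_F\<close> by \<open>G\<close> on the left and by \<open>E u\<close>
  on the right expresses t G A_u through the first-passage matrices alone, as needed to compare the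
  logarithmic derivatives.\<close>

lemma X_G_A:
  assumes u: "u \<in> letters"
  shows "fps_X \<cdot>\<^sub>m (G * A u) = F u * E u"
proof -
  note E = E_props[OF u]
  have "F u = (G * W) * F u" by (simp add: G_W)
  also have "\<dots> = G * (W * F u)" by (rule assoc_mult_mat) auto
  also have "\<dots> = fps_X \<cdot>\<^sub>m (G * (A u * C u))"
    unfolding W_F[OF u] by (rule mult_smult_distrib[of _ d d _ d]) auto
  also have "G * (A u * C u) = (G * A u) * C u"
    by (rule assoc_mult_mat[symmetric, of _ d d _ d _ d]) auto
  finally have "F u * E u = (fps_X \<cdot>\<^sub>m ((G * A u) * C u)) * E u" by simp
  also have "\<dots> = fps_X \<cdot>\<^sub>m (((G * A u) * C u) * E u)"
    using E by (intro mult_smult_assoc_mat[of _ d d _ d]) (auto intro!: mult_carrier_mat)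
  also have "((G * A u) * C u) * E u = (G * A u) * (C u * E u)"
    using E by (intro assoc_mult_mat[of _ d d _ d _ d]) auto
  also have "\<dots> = G * A u"
    unfolding E(2) by (rule right_mult_one_mat[of _ d d]) auto
  finally show ?thesis by simp
qed

text \<open>The push-through identity: (1 - F_u F_-u) F_u = F_u (1 - F_-u F_u), with both factors
  inverted.\<close>

lemma E_F_swap:
  assumes u: "u \<in> letters"
  shows "E (- u) * F u = F u * E u"
proof -
  note E = E_props[OF u] and E' = E_props[OF uminus_letters[OF u]]
  have "C (- u) * F u = F u * C u"
    unfolding C_def
    by (simp add: minus_mult_distrib_mat[of _ d d _ _ d] mult_minus_distrib_mat[of _ d d _ d]
        assoc_mult_mat[of _ d d _ d _ d])
  then have "E (- u) * (C (- u) * F u) * E u = E (- u) * (F u * C u) * E u" by simp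
  moreover have "E (- u) * (C (- u) * F u) * E u = F u * E u"
    using E E' by (simp add: assoc_mult_mat[symmetric, of _ d d _ d _ d] del: assoc_mult_mat)
  moreover have "E (- u) * (F u * C u) * E u = E (- u) * F u"
    using E E' by (simp add: assoc_mult_mat[of _ d d _ d _ d])
  ultimately show ?thesis by simp
qed

text \<open>Jacobi's formula and the product rule for F_x F_-x give two traces. Cyclicity turns the
  first into \<open>T x\<close>, and \<open>E_F_swap\<close> turns the second into
  \<open>T (- x)\<close>.\<close>

lemma deriv_det_C:
  assumes x: "x \<in> letters"
  shows "fps_deriv (det (C (- x))) = det (C (- x)) * - (T x + T (- x))"
proof -
  let ?D = "map_mat fps_deriv"
  note E = E_props[OF x] and E' = E_props[OF uminus_letters[OF x]]
  have "?D (C (- x)) = - ?D (F x * F (- x))"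
    by (rule eq_matI) (auto simp: C_def simp del: index_mult_mat(1))
  also have "\<dots> = - (?D (F x) * F (- x) + F x * ?D (F (- x)))"
    by (subst map_mat_fps_deriv_mult[of _ d d _ d]) auto
  finally have "E (- x) * ?D (C (- x)) = - (E (- x) * (?D (F x) * F (- x) + F x * ?D (F (- x))))"
    using E'(1) by (simp add: mult_add_distrib_mat[of _ d d _ d])
  also have "E (- x) * (?D (F x) * F (- x) + F x * ?D (F (- x)))
      = E (- x) * (?D (F x) * F (- x)) + E (- x) * (F x * ?D (F (- x)))"
    using E'(1) by (intro mult_add_distrib_mat[of _ d d _ d]) auto
  finally have "mat_trace (E (- x) * ?D (C (- x)))
      = - (mat_trace (E (- x) * (?D (F x) * F (- x))) + mat_trace (E (- x) * (F x * ?D (F (- x)))))"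
    using E'(1) by (simp add: mat_trace_uminus[of _ d] mat_trace_add[of _ d])
  also have "mat_trace (E (- x) * (?D (F x) * F (- x))) = T x"
  proof -
    have "E (- x) * (?D (F x) * F (- x)) = (E (- x) * ?D (F x)) * F (- x)"
      using E'(1) by (intro assoc_mult_mat[symmetric, of _ d d _ d _ d]) auto
    also have "mat_trace \<dots> = mat_trace (F (- x) * (E (- x) * ?D (F x)))"
      using E'(1) by (intro mat_trace_mult_comm[of _ d d]) auto
    also have "F (- x) * (E (- x) * ?D (F x)) = F (- x) * E (- x) * ?D (F x)"
      using E'(1) by (intro assoc_mult_mat[symmetric, of _ d d _ d _ d]) auto
    finally show ?thesis by (simp add: T_def)
  qed
  also have "E (- x) * (F x * ?D (F (- x))) = E (- x) * F x * ?D (F (- x))"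
    using E'(1) by (intro assoc_mult_mat[symmetric, of _ d d _ d _ d]) auto
  also have "mat_trace \<dots> = T (- x)"
    by (simp add: T_def E_F_swap[OF x])
  finally show ?thesis
    using fps_deriv_det[OF _ E'(1,3)] by simp
qed

text \<open>In Jacobi's formula for \<open>G\<close>, the derivative of W = 1 - t V_0 contributes
  two terms: t V_0 G is G - 1 by \<open>G_eq\<close>, and the derivative of V_0 yields the
  \<open>T v\<close>.\<close>

lemma deriv_det_G:
  "fps_X * fps_deriv (det G) = det G * (mat_trace G - of_nat d + fps_X * sum T letters)"
proof -
  let ?D = "map_mat fps_deriv"
  have DV: "?D (V 0) \<in> carrier_mat d d" "?D W \<in> carrier_mat d d" "?D G \<in> carrier_mat d d"
    by (simp_all add: W_def)
  \<comment> \<open>Differentiating W G = 1 trades the derivative of \<open>G\<close> for that of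
    \<open>W\<close>.\<close>
  have "?D (W * G) = ?D W * G + W * ?D G"
    by (rule map_mat_fps_deriv_mult[of _ d d _ d]) auto
  moreover have "?D (W * G) = 0\<^sub>m d d" unfolding W_G by (rule eq_matI) auto
  ultimately have "?D W * G + W * ?D G = 0\<^sub>m d d" by simp
  then have "0 = mat_trace (?D W * G + W * ?D G)"
    by (simp only: mat_trace_def) simp
  also have "\<dots> = mat_trace (?D W * G) + mat_trace (W * ?D G)"
    using DV by (intro mat_trace_add[of _ d]) auto
  finally have "mat_trace (W * ?D G) = - mat_trace (?D W * G)"
    by (simp add: eq_neg_iff_add_eq_0 add.commute)
  also have "?D W = - (V 0 + fps_X \<cdot>\<^sub>m ?D (V 0))"
    by (rule eq_matI) (auto simp: W_def)
  also have "- (V 0 + fps_X \<cdot>\<^sub>m ?D (V 0)) * G = - ((V 0 + fps_X \<cdot>\<^sub>m ?D (V 0)) * G)"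
    using DV by simp
  also have "(V 0 + fps_X \<cdot>\<^sub>m ?D (V 0)) * G = V 0 * G + fps_X \<cdot>\<^sub>m (?D (V 0) * G)"
    using DV by (simp add: add_mult_distrib_mat[of _ d d _ _ d] mult_smult_assoc_mat[of _ d d _ d])
  also have "- mat_trace (- (V 0 * G + fps_X \<cdot>\<^sub>m (?D (V 0) * G)))
      = mat_trace (V 0 * G) + fps_X * mat_trace (?D (V 0) * G)"
    using DV by (simp add: mat_trace_uminus[of _ d] mat_trace_add[of _ d] mat_trace_smult[of _ d])
  finally have 1: "mat_trace (W * ?D G) = mat_trace (V 0 * G) + fps_X * mat_trace (?D (V 0) * G)" .
  have 2: "fps_X * mat_trace (V 0 * G) = mat_trace G - of_nat d"
  proof -
    have "mat_trace G = mat_trace (1\<^sub>m d + fps_X \<cdot>\<^sub>m (V 0 * G))" by (subst G_eq) simp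
    also have "\<dots> = of_nat d + fps_X * mat_trace (V 0 * G)"
      by (simp add: mat_trace_add[of _ d] mat_trace_smult[of _ d] mat_trace_one)
    finally show ?thesis by simp
  qed
  \<comment> \<open>The matrices \<open>A u\<close> are constant, so only the \<open>F v\<close> are
    differentiated; cyclicity of the trace then brings \<open>G\<close> next to
    \<open>A (- v)\<close>, where \<open>X_G_A\<close> applies.\<close>
  have 3: "fps_X * mat_trace (?D (V 0) * G) = sum T letters"
  proof -
    have "letters - {- 0} = letters" using zero_not_letter by simp
    moreover have "fps_deriv ((A (- v) * F v) $$ (i, k)) = (A (- v) * ?D (F v)) $$ (i, k)"
      if "i < d" "k < d" for v i k
      using that by (simp add: mult_mat_entry[of _ d _ d _ d] A_entry F_entry fps_deriv_sum del: index_mult_mat(1))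
    ultimately have DV_entry: "?D (V 0) $$ (i, k) = (\<Sum>v\<in>letters. (A (- v) * ?D (F v)) $$ (i, k))"
      if "i < d" "k < d" for i k
      using that by (simp add: V_entry fps_deriv_sum del: index_mult_mat(1))
    have "mat_trace (?D (V 0) * G) = (\<Sum>i<d. \<Sum>k<d. \<Sum>v\<in>letters. (A (- v) * ?D (F v)) $$ (i, k) * G $$ (k, i))"
      unfolding mat_trace_mult[OF DV(1) carriers(4)]
      by (intro sum.cong refl) (simp only: DV_entry lessThan_iff sum_distrib_right)
    also have "\<dots> = (\<Sum>i<d. \<Sum>v\<in>letters. \<Sum>k<d. (A (- v) * ?D (F v)) $$ (i, k) * G $$ (k, i))"
      by (intro sum.cong refl sum.swap)
    also have "\<dots> = (\<Sum>v\<in>letters. \<Sum>i<d. \<Sum>k<d. (A (- v) * ?D (F v)) $$ (i, k) * G $$ (k, i))"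
      by (rule sum.swap)
    also have "\<dots> = (\<Sum>v\<in>letters. mat_trace (A (- v) * ?D (F v) * G))"
      by (intro sum.cong refl mat_trace_mult[symmetric, of _ d d]) auto
    finally have "fps_X * mat_trace (?D (V 0) * G) = (\<Sum>v\<in>letters. fps_X * mat_trace (A (- v) * ?D (F v) * G))"
      by (simp add: sum_distrib_left)
    also have "\<dots> = sum T letters"
    proof (rule sum.cong[OF refl])
      fix v assume "v \<in> letters"
      then have v: "- v \<in> letters" by (rule uminus_letters)
      have "fps_X * mat_trace (A (- v) * ?D (F v) * G) = fps_X * mat_trace (G * (A (- v) * ?D (F v)))"
        by (subst mat_trace_mult_comm[of _ d d]) auto
      also have "G * (A (- v) * ?D (F v)) = (G * A (- v)) * ?D (F v)"
        by (rule assoc_mult_mat[symmetric, of _ d d _ d _ d]) auto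
      also have "fps_X * mat_trace ((G * A (- v)) * ?D (F v)) = mat_trace (fps_X \<cdot>\<^sub>m ((G * A (- v)) * ?D (F v)))"
        by (subst mat_trace_smult[of _ d]) auto
      also have "fps_X \<cdot>\<^sub>m ((G * A (- v)) * ?D (F v)) = (fps_X \<cdot>\<^sub>m (G * A (- v))) * ?D (F v)"
        by (rule mult_smult_assoc_mat[symmetric, of _ d d _ d]) auto
      finally show "fps_X * mat_trace (A (- v) * ?D (F v) * G) = T v"
        unfolding X_G_A[OF v] T_def .
    qed
    finally show ?thesis .
  qed
  have "fps_deriv (det G) = det G * mat_trace (W * ?D G)"
    by (rule fps_deriv_det[OF _ _ W_G]) auto
  then have "fps_X * fps_deriv (det G) = det G * (fps_X * mat_trace (W * ?D G))" by (simp add: mult_ac)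
  also have "fps_X * mat_trace (W * ?D G) = mat_trace G - of_nat d + fps_X * sum T letters"
    unfolding 1 2[symmetric] 3[symmetric] by (simp add: algebra_simps)
  finally show ?thesis .
qed

section \<open>Closed form and algebraicity of the zeta function\<close>

definition Z :: "rat fps" where "Z = det G * (\<Prod>x\<in>S. det (C (- x)))"

text \<open>\<open>S\<close> contains one letter of each inverse pair, so the sum of the
  \<open>T x\<close> over all letters cancels between the two factors of \<open>Z\<close>.\<close>

lemma deriv_Z: "fps_X * fps_deriv Z = (mat_trace G - of_nat d) * Z"
proof -
  have "fps_deriv (\<Prod>x\<in>S. det (C (- x))) = (\<Prod>x\<in>S. det (C (- x))) * (\<Sum>x\<in>S. - (T x + T (- x)))"
    using finite_S by (intro fps_deriv_prod_log deriv_det_C) (auto simp: letters_def)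
  also have "(\<Sum>x\<in>S. - (T x + T (- x))) = - sum T letters"
    unfolding sum_letters_split by (rule sum_negf)
  finally have *: "fps_deriv (\<Prod>x\<in>S. det (C (- x))) = (\<Prod>x\<in>S. det (C (- x))) * - sum T letters" .
  have "fps_X * fps_deriv Z = (fps_X * fps_deriv (det G)) * (\<Prod>x\<in>S. det (C (- x)))
      + det G * (fps_X * fps_deriv (\<Prod>x\<in>S. det (C (- x))))"
    unfolding Z_def by (simp add: algebra_simps)
  then show ?thesis
    unfolding deriv_det_G * Z_def by (simp add: algebra_simps)
qed

lemma G_nth_0: "i < d \<Longrightarrow> j < d \<Longrightarrow> G $$ (i, j) $ 0 = (if i = j then 1 else 0)"
  by (subst G_eq) (simp del: index_mult_mat(1))

lemma Z_nth_0: "Z $ 0 = 1"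
proof -
  have "map_mat (\<lambda>f. f $ 0) G = 1\<^sub>m d" by (rule eq_matI) (auto simp: G_nth_0)
  then have "det G $ 0 = 1" by (simp add: det_fps_nth_0)
  moreover have "(\<Prod>x\<in>B. det (C (- x))) $ 0 = 1" if "finite B" "B \<subseteq> S" for B
    using that by (induction B rule: finite_induct) (auto simp: letters_def det_C_nth_0)
  ultimately show ?thesis using finite_S by (simp add: Z_def)
qed

text \<open>Both series have constant coefficient 1 and solve t f' = (tr G - d) f; subtracting d
  removes the constant coefficient of tr G, which is absent from the exponent.\<close>

lemma zeta_fps_eq_Z: "zeta_fps M = Z"
proof -
  define L where "L = Abs_fps (\<lambda>k. if k = 0 then 0 else zeta_coeff M k / of_nat k)"
  have L0: "L $ 0 = 0" by (simp add: L_def)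
  have zeta: "zeta_fps M = fps_exp 1 oo L" by (simp add: zeta_fps_def L_def)
  have "fps_deriv (zeta_fps M) = fps_deriv L * zeta_fps M"
    unfolding zeta by (simp add: fps_compose_deriv[OF L0] mult.commute)
  moreover have "fps_X * fps_deriv L = mat_trace G - of_nat d"
  proof (rule fps_ext)
    fix n
    have "mat_trace G $ 0 = of_nat d"
      by (simp add: mat_trace_def fps_sum_nth G_nth_0)
    then show "(fps_X * fps_deriv L) $ n = (mat_trace G - of_nat d) $ n"
      by (cases n) (simp_all add: L_def zeta_coeff_eq fps_of_nat[symmetric] del: of_nat_Suc)
  qed
  then have "fps_X * fps_deriv Z = fps_X * (fps_deriv L * Z)"
    using deriv_Z by (simp add: mult.assoc)
  then have "fps_deriv Z = fps_deriv L * Z" by simp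
  moreover have "zeta_fps M $ 0 = Z $ 0"
    by (simp add: zeta Z_nth_0 L0)
  ultimately show ?thesis by (rule fps_linear_ode_unique)
qed

text \<open>The solution of the system contains t G instead of \<open>G\<close>, so t^d times the
  zeta function lies in the ring it generates; the power of t is cancelled afterwards.\<close>

lemma zeta_fps_algebraic: "fps_algebraic (zeta_fps M)"
proof -
  let ?R = "gen_ring (y ` idx)"
  have F_ring: "F x $$ (i, j) \<in> ?R" if "x \<in> insert 0 letters" "i < d" "j < d" for x i j
    using that by (auto simp: F_entry idx_def intro!: gen_ring.gen)
  have "det (F 0) \<in> ?R" by (rule gen_ring_det[of _ d]) (auto intro: F_ring)
  moreover have "det (C (- x)) \<in> ?R" if "x \<in> S" for x
  proof (rule gen_ring_det[of _ d])
    fix i j assume ij: "i < d" "j < d"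
    have "x \<in> letters" "- x \<in> letters" using that by (auto simp: letters_def)
    then have "(F x * F (- x)) $$ (i, j) \<in> ?R"
      using ij by (subst mult_mat_entry[of _ d _ d _ d]) (auto intro!: gen_ring_sum gen_ring.mult F_ring)
    moreover have "1\<^sub>m d $$ (i, j) \<in> ?R" using ij by (auto intro: gen_ring.one gen_ring_zero)
    ultimately have "1\<^sub>m d $$ (i, j) - (F x * F (- x)) $$ (i, j) \<in> ?R" by (rule gen_ring_diff[rotated])
    then show "C (- x) $$ (i, j) \<in> ?R"
      using ij by (simp add: C_def del: index_mult_mat(1) index_one_mat(1))
  qed simp
  ultimately have "det (F 0) * (\<Prod>x\<in>S. det (C (- x))) \<in> ?R"
    by (intro gen_ring.mult gen_ring_prod)
  also have "det (F 0) * (\<Prod>x\<in>S. det (C (- x))) = fps_X ^ d * zeta_fps M"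
    by (simp add: F_0_eq zeta_fps_eq_Z Z_def mult.assoc)
  finally have "fps_algebraic (fps_X ^ d * zeta_fps M)"
    using finite_letters y_quad_system
    by (intro quad_system_gen_ring_algebraic[of idx y qc ql qq]) (auto simp: idx_def)
  then show ?thesis by (rule fps_algebraic_X_power_cancel)
qed

end

section \<open>Reduction to matrices supported on the letters\<close>

lemma fps_compose_square_nth:
  fixes f :: "'a::comm_ring_1 fps"
  shows "(f oo fps_X ^ 2) $ n = (if even n then f $ (n div 2) else 0)"
proof -
  have "(f oo fps_X ^ 2) $ n = (\<Sum>i=0..n. if n = 2 * i then f $ i else 0)"
    by (simp add: fps_compose_nth fps_X_power_nth if_distrib[of "\<lambda>x. _ * x"] flip: power_mult cong: if_cong)
  also have "\<dots> = (\<Sum>i=0..n. if i = n div 2 then (if even n then f $ i else 0) else 0)"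
    by (intro sum.cong) (auto elim!: evenE oddE)
  also have "\<dots> = (if even n then f $ (n div 2) else 0)" by simp
  finally show ?thesis .
qed

definition fps_even_part :: "'a fps \<Rightarrow> 'a fps" where
  "fps_even_part f = Abs_fps (\<lambda>n. f $ (2 * n))"

text \<open>Taking even parts is linear over series in t^2, which are identified with series in
  t.\<close>

lemma fps_even_part_mult_compose_square:
  fixes f g :: "'a::comm_ring_1 fps"
  shows "fps_even_part ((f oo fps_X ^ 2) * g) = f * fps_even_part g"
proof (rule fps_ext)
  fix n
  have "fps_even_part ((f oo fps_X ^ 2) * g) $ n =
      (\<Sum>i=0..2 * n. (if even i then f $ (i div 2) * g $ (2 * n - i) else 0))"
    by (simp add: fps_even_part_def fps_mult_nth fps_compose_square_nth if_distrib[of "\<lambda>x. x * _"] cong: if_cong)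
  also have "\<dots> = (\<Sum>i\<in>(\<lambda>i. 2 * i) ` {0..n}. f $ (i div 2) * g $ (2 * n - i))"
    by (rule sum.mono_neutral_cong_right) (auto elim!: evenE)
  also have "\<dots> = (\<Sum>i=0..n. f $ i * g $ (2 * n - 2 * i))"
    by (subst sum.reindex) (auto simp: inj_on_def)
  finally show "fps_even_part ((f oo fps_X ^ 2) * g) $ n = (f * fps_even_part g) $ n"
    by (simp add: fps_even_part_def fps_mult_nth right_diff_distrib')
qed

definition poly_even_part :: "'a::comm_ring_1 poly \<Rightarrow> 'a poly" where
  "poly_even_part p = (\<Sum>n\<le>degree p. monom (coeff p (2 * n)) n)"

lemma coeff_poly_even_part: "coeff (poly_even_part p) n = coeff p (2 * n)"
  by (auto simp: poly_even_part_def coeff_sum coeff_eq_0)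

lemma fps_of_poly_even_part: "fps_of_poly (poly_even_part p) = fps_even_part (fps_of_poly p)"
  by (rule fps_ext) (simp add: coeff_poly_even_part fps_even_part_def)

lemma fps_even_part_poly:
  fixes f :: "'a::comm_ring_1 fps"
  shows "fps_even_part (poly (map_poly fps_of_poly p) (f oo fps_X ^ 2))
    = poly (map_poly fps_of_poly (map_poly poly_even_part p)) f"
proof (induction p)
  case 0
  then show ?case by (simp add: fps_even_part_def fps_eq_iff)
next
  case (pCons c p)
  interpret h: comm_ring_hom "fps_of_poly :: 'a poly \<Rightarrow> 'a fps"
    by (rule comm_ring_hom_fps_of_poly)
  have "map_poly poly_even_part (pCons c p) = pCons (poly_even_part c) (map_poly poly_even_part p)"
    by (rule poly_eqI)
      (simp add: coeff_map_poly coeff_pCons poly_even_part_def[of 0] split: nat.split)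
  moreover have "fps_even_part (u + v) = fps_even_part u + fps_even_part v" for u v :: "'a fps"
    by (simp add: fps_even_part_def fps_eq_iff)
  ultimately show ?case
    using pCons by (simp add: h.map_poly_pCons_hom fps_even_part_mult_compose_square fps_of_poly_even_part)
qed

text \<open>Taking even parts of an equation for f(t^2) gives one for f, provided that some even
  power of t occurs in its coefficients.\<close>

lemma fps_algebraic_compose_square_cancel:
  fixes f :: "'a::idom fps"
  assumes "fps_algebraic (f oo fps_X ^ 2)"
  shows "fps_algebraic f"
proof -
  interpret h: comm_ring_hom "fps_of_poly :: 'a poly \<Rightarrow> 'a fps"
    by (rule comm_ring_hom_fps_of_poly)
  obtain p where p: "p \<noteq> 0" "poly (map_poly fps_of_poly p) (f oo fps_X ^ 2) = 0"
    using assms by (auto simp: fps_algebraic_def)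
  have *: "fps_algebraic f" if "poly (map_poly fps_of_poly q) (f oo fps_X ^ 2) = 0"
    "coeff (coeff q k) (2 * n) \<noteq> 0" for q k n
  proof -
    have "map_poly poly_even_part q \<noteq> 0"
    proof
      assume "map_poly poly_even_part q = 0"
      then have "coeff (coeff (map_poly poly_even_part q) k) n = 0" by simp
      then show False
        using that(2) by (simp add: coeff_map_poly poly_even_part_def[of 0] coeff_poly_even_part)
    qed
    moreover have "poly (map_poly fps_of_poly (map_poly poly_even_part q)) f = 0"
      using fps_even_part_poly[of q f] that(1) by (simp add: fps_even_part_def fps_eq_iff)
    ultimately show ?thesis by (auto simp: fps_algebraic_def)
  qed
  obtain k n where kn: "coeff (coeff p k) n \<noteq> 0" using p(1) by (metis leading_coeff_0_iff)
  show ?thesis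
  proof (cases "even n")
    case True
    then show ?thesis using *[of p k "n div 2"] p kn by simp
  next
    case False
    \<comment> \<open>If only an odd power is known to occur, multiplication by t makes it
      even.\<close>
    let ?q = "Polynomial.smult [:0, 1:] p"
    have "poly (map_poly fps_of_poly ?q) (f oo fps_X ^ 2) = 0"
      using p(2) by (simp add: h.map_poly_hom_smult)
    moreover have "coeff (coeff ?q k) (2 * Suc (n div 2)) \<noteq> 0"
      using kn False by simp
    ultimately show ?thesis by (rule *)
  qed
qed

section \<open>Cyclicity and the antidiagonal block matrix\<close>

text \<open>In a group u v = 1 is equivalent to v u = 1.\<close>

lemma lookup_mult_0_commute:
  fixes p q :: "'f::group_add \<Rightarrow>\<^sub>0 'a::comm_semiring_0"
  shows "Poly_Mapping.lookup (p * q) 0 = Poly_Mapping.lookup (q * p) 0"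
proof -
  \<comment> \<open>This set covers the support of \<open>p\<close> and its negatives cover that of
    \<open>q\<close>, so both convolutions are sums over it.\<close>
  let ?U = "Poly_Mapping.keys p \<union> uminus ` Poly_Mapping.keys q"
  have "Poly_Mapping.lookup (p * q) 0 = (\<Sum>u\<in>?U. Poly_Mapping.lookup p u * Poly_Mapping.lookup q (- u))"
    by (subst lookup_mult_group[of ?U]) auto
  also have "\<dots> = (\<Sum>v\<in>uminus ` ?U. Poly_Mapping.lookup q v * Poly_Mapping.lookup p (- v))"
    by (subst sum.reindex) (auto simp: inj_on_def mult.commute)
  also have "\<dots> = Poly_Mapping.lookup (q * p) 0"
  proof (subst lookup_mult_group[of "uminus ` ?U"])
    show "Poly_Mapping.keys q \<subseteq> uminus ` ?U" by (force simp: image_iff)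
  qed auto
  finally show ?thesis .
qed

text \<open>The group algebra is in general noncommutative, so the trace alone is not cyclic, but
  its coefficient at the identity is.\<close>

lemma lookup_trace_mult_commute:
  fixes P Q :: "('f::group_add \<Rightarrow>\<^sub>0 rat) mat"
  assumes "P \<in> carrier_mat n m" "Q \<in> carrier_mat m n"
  shows "Poly_Mapping.lookup (mat_trace (P * Q)) 0 = Poly_Mapping.lookup (mat_trace (Q * P)) 0"
  unfolding mat_trace_mult[OF assms] mat_trace_mult[OF assms(2,1)] lookup_sum
  by (subst sum.swap) (intro sum.cong refl lookup_mult_0_commute)

lemma pow_mat_rotate:
  fixes P Q :: "'a::semiring_1 mat"
  assumes P: "P \<in> carrier_mat n m" and Q: "Q \<in> carrier_mat m n"
  shows "(Q * P) ^\<^sub>m Suc k = Q * ((P * Q) ^\<^sub>m k * P)"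
proof (induction k)
  case 0
  then show ?case using P Q by simp
next
  case (Suc k)
  let ?B = "(P * Q) ^\<^sub>m k"
  have PQ: "P * Q \<in> carrier_mat n n" and B: "?B \<in> carrier_mat n n"
    using P Q by auto
  have BP: "?B * P \<in> carrier_mat n m" using B P by simp
  have "(Q * P) ^\<^sub>m Suc (Suc k) = (Q * (?B * P)) * (Q * P)" using Suc by simp
  also have "\<dots> = Q * ((?B * P) * (Q * P))"
    using Q BP P by (intro assoc_mult_mat[of _ m n _ m _ m]) auto
  also have "(?B * P) * (Q * P) = ((?B * P) * Q) * P"
    by (rule assoc_mult_mat[symmetric, OF BP Q P])
  also have "(?B * P) * Q = ?B * (P * Q)" by (rule assoc_mult_mat[OF B P Q])
  finally show ?case by simp
qed

lemma mat_trace_four_block: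
  assumes "A \<in> carrier_mat n n" "B \<in> carrier_mat n m" "C \<in> carrier_mat m n" "D \<in> carrier_mat m m"
  shows "mat_trace (four_block_mat A B C D) = mat_trace A + mat_trace D"
proof -
  have split: "(\<Sum>i<n + m. f i) = (\<Sum>i<n. f i) + (\<Sum>i<m. f (n + i))" for f :: "nat \<Rightarrow> 'a"
    by (induction m) (auto simp: add.assoc)
  show ?thesis using assms by (simp add: mat_trace_def split)
qed

text \<open>The square of the block matrix is diagonal with blocks P Q and Q P, whose powers have
  the same zeta coefficients; odd powers have zero trace. The resulting factor 2 cancels against the
  denominator 2 k.\<close>

lemma zeta_fps_antidiagonal:
  fixes P Q :: "('f::group_add \<Rightarrow>\<^sub>0 rat) mat"
  assumes P: "P \<in> carrier_mat n m" and Q: "Q \<in> carrier_mat m n"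
  shows "zeta_fps (four_block_mat (0\<^sub>m n n) P Q (0\<^sub>m m m)) = zeta_fps (P * Q) oo fps_X ^ 2"
proof -
  let ?N = "four_block_mat (0\<^sub>m n n) P Q (0\<^sub>m m m)"
  have N: "?N \<in> carrier_mat (n + m) (n + m)" by simp
  have PQ: "P * Q \<in> carrier_mat n n" "Q * P \<in> carrier_mat m m" using P Q by auto
  have NN: "?N * ?N = four_block_mat (P * Q) (0\<^sub>m n m) (0\<^sub>m m n) (Q * P)"
    using P Q PQ by (subst mult_four_block_mat[of _ n n _ m _ m _ _ n _ m]) auto
  have "?N ^\<^sub>m (2 * k) = (?N * ?N) ^\<^sub>m k" for k
  proof (induction k)
    case 0
    then show ?case by simp
  next
    case (Suc k)
    have "?N ^\<^sub>m (2 * Suc k) = ?N ^\<^sub>m (2 * k) * ?N * ?N" by simp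
    also have "\<dots> = ?N ^\<^sub>m (2 * k) * (?N * ?N)"
      by (rule assoc_mult_mat[OF pow_carrier_mat[OF N] N N])
    finally show ?case using Suc by simp
  qed
  then have even_pow: "?N ^\<^sub>m (2 * k) =
      four_block_mat ((P * Q) ^\<^sub>m k) (0\<^sub>m n m) (0\<^sub>m m n) ((Q * P) ^\<^sub>m k)" for k
    unfolding NN pow_four_block_mat[OF PQ] by simp
  have pows: "(P * Q) ^\<^sub>m k \<in> carrier_mat n n" "(Q * P) ^\<^sub>m k \<in> carrier_mat m m" for k
    using PQ by auto
  have rotate: "zeta_coeff (Q * P) k = zeta_coeff (P * Q) k" if k0: "k > 0" for k
  proof -
    obtain l where k: "k = Suc l" using k0 by (cases k) auto
    have B: "(P * Q) ^\<^sub>m l * P \<in> carrier_mat n m" by (rule mult_carrier_mat[OF pows(1) P])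
    have "(P * Q) ^\<^sub>m l * P * Q = (P * Q) ^\<^sub>m l * (P * Q)"
      by (rule assoc_mult_mat[OF pows(1) P Q])
    then show ?thesis
      unfolding zeta_coeff_def k pow_mat_rotate[OF P Q] lookup_trace_mult_commute[OF Q B] by simp
  qed
  have even_coeff: "zeta_coeff ?N (2 * k) = 2 * zeta_coeff (P * Q) k" if "k > 0" for k
    using rotate[OF that] pows[of k]
    by (simp add: zeta_coeff_def even_pow mat_trace_four_block[of _ n _ m] lookup_add)
  have odd_coeff: "zeta_coeff ?N (Suc (2 * k)) = 0" for k
  proof -
    have "?N ^\<^sub>m Suc (2 * k) = four_block_mat ((P * Q) ^\<^sub>m k * 0\<^sub>m n n + 0\<^sub>m n m * Q)
        ((P * Q) ^\<^sub>m k * P + 0\<^sub>m n m * 0\<^sub>m m m) (0\<^sub>m m n * 0\<^sub>m n n + (Q * P) ^\<^sub>m k * Q)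
        (0\<^sub>m m n * P + (Q * P) ^\<^sub>m k * 0\<^sub>m m m)"
      unfolding pow_mat.simps even_pow using pows[of k] P Q
      by (intro mult_four_block_mat[of _ n n _ m _ m _ _ n _ m]) auto
    then have "mat_trace (?N ^\<^sub>m Suc (2 * k)) =
        mat_trace ((P * Q) ^\<^sub>m k * 0\<^sub>m n n + 0\<^sub>m n m * Q) +
        mat_trace (0\<^sub>m m n * P + (Q * P) ^\<^sub>m k * 0\<^sub>m m m)"
      using pows[of k] P Q by (simp only:) (rule mat_trace_four_block[of _ n _ m]; auto)
    also have "\<dots> = 0" using pows[of k] P Q by (simp add: mat_trace_def)
    finally show ?thesis by (simp add: zeta_coeff_def)
  qed
  let ?L = "\<lambda>M. Abs_fps (\<lambda>k. if k = 0 then 0 else zeta_coeff M k / of_nat k)"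
  have "?L ?N = ?L (P * Q) oo fps_X ^ 2"
  proof (rule fps_ext)
    fix k
    show "?L ?N $ k = (?L (P * Q) oo fps_X ^ 2) $ k"
    proof (cases "even k")
      case True
      then obtain l where "k = 2 * l" by (rule evenE)
      then show ?thesis by (auto simp: fps_compose_square_nth even_coeff)
    next
      case False
      then obtain l where "k = Suc (2 * l)" by (metis oddE Suc_eq_plus1)
      then show ?thesis by (simp add: fps_compose_square_nth odd_coeff del: pow_mat.simps)
    qed
  qed
  then show ?thesis
    unfolding zeta_fps_def by (simp add: fps_compose_assoc)
qed

lemma poly_mapping_sum_single:
  "(\<Sum>g\<in>Poly_Mapping.keys p. Poly_Mapping.single g (Poly_Mapping.lookup p g)) = p"
  by (rule poly_mapping_eqI) (auto simp: lookup_sum lookup_single when_def in_keys_iff)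

section \<open>Splitting words in the middle\<close>

context tree_group
begin

definition ball :: "nat \<Rightarrow> 'f set" where
  "ball m = sum_list ` {w. set w \<subseteq> letters \<and> length w \<le> m}"

lemma finite_ball: "finite (ball m)"
  unfolding ball_def by (intro finite_imageI finite_lists_length_le finite_letters)

lemma ball_1: "ball 1 = insert 0 letters"
proof -
  have "{w. set w \<subseteq> letters \<and> length w \<le> 1} = insert [] ((\<lambda>x. [x]) ` letters)"
    by (auto simp: le_Suc_eq length_Suc_conv)
  then show ?thesis by (simp add: ball_def image_image)
qed

lemma in_ball_length: "length (nf g) \<le> m \<Longrightarrow> g \<in> ball m"
  unfolding ball_def using nf_set[of g] nf_sum[of g]
  by (intro image_eqI[of _ _ "nf g"]) (auto simp: letters_def)

lemma ball_split:
  assumes "g \<in> ball (2 * m)"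
  obtains u where "u \<in> ball m" "- u + g \<in> ball m"
proof -
  from assms obtain w where w: "g = sum_list w" "set w \<subseteq> letters" "length w \<le> 2 * m"
    by (auto simp: ball_def)
  let ?u = "sum_list (take m w)"
  have "g = ?u + sum_list (drop m w)"
    unfolding w(1) by (metis append_take_drop_id sum_list_append)
  then have "- ?u + g = sum_list (drop m w)" by (simp flip: add.assoc)
  moreover have "?u \<in> ball m" "sum_list (drop m w) \<in> ball m"
    unfolding ball_def using w(2,3) set_take_subset[of m w] set_drop_subset[of m w]
    by (auto intro!: imageI)
  ultimately show ?thesis using that[of ?u] by simp
qed

text \<open>The inner index runs over pairs of a row k and a first half u: \<open>P\<close> records
  u in row k, and \<open>Q\<close> records what is left of the entries of that row.\<close>

lemma matrix_factor_ball:
  fixes M :: "('f \<Rightarrow>\<^sub>0 rat) mat"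
  assumes M: "M \<in> carrier_mat d d"
    and keys: "\<And>i j. i < d \<Longrightarrow> j < d \<Longrightarrow> Poly_Mapping.keys (M $$ (i, j)) \<subseteq> ball (2 * m)"
  obtains K P Q where "P \<in> carrier_mat d K" "Q \<in> carrier_mat K d" "M = P * Q"
    "\<And>i j. i < d \<Longrightarrow> j < K \<Longrightarrow> Poly_Mapping.keys (P $$ (i, j)) \<subseteq> ball m"
    "\<And>i j. i < K \<Longrightarrow> j < d \<Longrightarrow> Poly_Mapping.keys (Q $$ (i, j)) \<subseteq> ball m"
proof -
  have "\<exists>u. g \<in> ball (2 * m) \<longrightarrow> u \<in> ball m \<and> - u + g \<in> ball m" for g
    by (metis ball_split)
  then obtain us where us: "\<And>g. g \<in> ball (2 * m) \<Longrightarrow> us g \<in> ball m \<and> - us g + g \<in> ball m"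
    by metis
  \<comment> \<open>This gathers the terms of p whose chosen first half is u, with u cancelled on
    the left.\<close>
  define part where "part u p = (\<Sum>g\<in>Poly_Mapping.keys p.
    if us g = u then Poly_Mapping.single (- u + g) (Poly_Mapping.lookup p g) else 0)"
    for u and p :: "'f \<Rightarrow>\<^sub>0 rat"
  have part_sum: "(\<Sum>u\<in>ball m. Poly_Mapping.single u 1 * part u p) = p"
    if "Poly_Mapping.keys p \<subseteq> ball (2 * m)" for p
  proof -
    have "(\<Sum>u\<in>ball m. Poly_Mapping.single u 1 * part u p) =
        (\<Sum>u\<in>ball m. \<Sum>g\<in>Poly_Mapping.keys p.
          if u = us g then Poly_Mapping.single g (Poly_Mapping.lookup p g) else 0)"
      unfolding part_def sum_distrib_left
      by (intro sum.cong refl) (auto simp: mult_single simp flip: add.assoc)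
    also have "\<dots> = (\<Sum>g\<in>Poly_Mapping.keys p. \<Sum>u\<in>ball m.
          if u = us g then Poly_Mapping.single g (Poly_Mapping.lookup p g) else 0)"
      by (rule sum.swap)
    also have "\<dots> = (\<Sum>g\<in>Poly_Mapping.keys p. Poly_Mapping.single g (Poly_Mapping.lookup p g))"
      using that us finite_ball by (intro sum.cong refl) (auto simp: sum.delta)
    finally show ?thesis by (simp add: poly_mapping_sum_single)
  qed
  have part_keys: "Poly_Mapping.keys (part u p) \<subseteq> ball m"
    if "Poly_Mapping.keys p \<subseteq> ball (2 * m)" for u p
    unfolding part_def
  proof (rule order_trans[OF keys_sum], rule UN_least)
    fix g assume "g \<in> Poly_Mapping.keys p"
    then have "- us g + g \<in> ball m" using that us by blast
    then show "Poly_Mapping.keys (if us g = u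
        then Poly_Mapping.single (- u + g) (Poly_Mapping.lookup p g) else 0) \<subseteq> ball m"
      by auto
  qed
  let ?I = "{..<d} \<times> ball m"
  have finI: "finite ?I" using finite_ball by simp
  define K where "K = card ?I"
  obtain h where h: "bij_betw h {0..<K} ?I"
    using ex_bij_betw_nat_finite[OF finI] unfolding K_def by blast
  have h_in: "fst (h c) < d" "snd (h c) \<in> ball m" if "c < K" for c
    using bij_betwE[OF h] that by (auto simp: mem_Times_iff)
  define P where "P = mat d K (\<lambda>(i, c). if fst (h c) = i then Poly_Mapping.single (snd (h c)) (1 :: rat) else 0)"
  define Q where "Q = mat K d (\<lambda>(c, j). part (snd (h c)) (M $$ (fst (h c), j)))"
  have carr: "P \<in> carrier_mat d K" "Q \<in> carrier_mat K d" by (auto simp: P_def Q_def)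
  have "M = P * Q"
  proof (rule eq_matI)
    fix i j assume "i < dim_row (P * Q)" "j < dim_col (P * Q)"
    then have ij: "i < d" "j < d" using carr by auto
    have "(P * Q) $$ (i, j) = (\<Sum>c\<in>{0..<K}. P $$ (i, c) * Q $$ (c, j))"
      using mult_mat_entry[OF ij carr] by (simp add: atLeast0LessThan)
    also have "\<dots> = (\<Sum>c\<in>{0..<K}. (if fst (h c) = i then Poly_Mapping.single (snd (h c)) 1 else 0)
        * part (snd (h c)) (M $$ (fst (h c), j)))"
      using ij by (intro sum.cong) (auto simp: P_def Q_def)
    also have "\<dots> = (\<Sum>z\<in>?I. (if fst z = i then Poly_Mapping.single (snd z) 1 else 0)
        * part (snd z) (M $$ (fst z, j)))"
      by (rule sum.reindex_bij_betw[OF h])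
    also have "\<dots> = (\<Sum>k<d. \<Sum>u\<in>ball m. (if k = i then Poly_Mapping.single u 1 else 0)
        * part u (M $$ (k, j)))"
      by (simp add: sum.cartesian_product case_prod_beta)
    also have "\<dots> = (\<Sum>k<d. if k = i then \<Sum>u\<in>ball m. Poly_Mapping.single u 1 * part u (M $$ (i, j)) else 0)"
      by (intro sum.cong refl) auto
    also have "\<dots> = M $$ (i, j)" using ij part_sum[OF keys] by simp
    finally show "M $$ (i, j) = (P * Q) $$ (i, j)" by simp
  qed (use M carr in auto)
  moreover have "Poly_Mapping.keys (P $$ (i, j)) \<subseteq> ball m" if "i < d" "j < K" for i j
    using that h_in by (auto simp: P_def)
  moreover have "Poly_Mapping.keys (Q $$ (i, j)) \<subseteq> ball m" if "i < K" "j < d" for i j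
    using that h_in part_keys[OF keys] by (simp add: Q_def)
  ultimately show ?thesis using that carr by blast
qed

text \<open>Each factorisation halves the radius at the cost of a larger matrix, until only the
  identity and the letters are left.\<close>

lemma zeta_fps_algebraic_ball:
  fixes M :: "('f \<Rightarrow>\<^sub>0 rat) mat"
  assumes "M \<in> carrier_mat d d"
    and "\<And>i j. i < d \<Longrightarrow> j < d \<Longrightarrow> Poly_Mapping.keys (M $$ (i, j)) \<subseteq> ball (2 ^ k)"
  shows "fps_algebraic (zeta_fps M)"
  using assms
proof (induction k arbitrary: M d)
  case 0
  then interpret tree_matrix S nf M d
    by unfold_locales (simp_all add: ball_1[unfolded One_nat_def])
  show ?case by (rule zeta_fps_algebraic)
next
  case (Suc k)
  have M: "M \<in> carrier_mat d d"
    and keys: "\<And>i j. i < d \<Longrightarrow> j < d \<Longrightarrow> Poly_Mapping.keys (M $$ (i, j)) \<subseteq> ball (2 * 2 ^ k)"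
    using Suc.prems by simp_all
  obtain K P Q where PQ: "P \<in> carrier_mat d K" "Q \<in> carrier_mat K d" "M = P * Q"
    "\<And>i j. i < d \<Longrightarrow> j < K \<Longrightarrow> Poly_Mapping.keys (P $$ (i, j)) \<subseteq> ball (2 ^ k)"
    "\<And>i j. i < K \<Longrightarrow> j < d \<Longrightarrow> Poly_Mapping.keys (Q $$ (i, j)) \<subseteq> ball (2 ^ k)"
    using matrix_factor_ball[OF M keys] by blast
  have "fps_algebraic (zeta_fps (four_block_mat (0\<^sub>m d d) P Q (0\<^sub>m K K)))"
  proof (rule Suc.IH)
    fix i j assume ij: "i < d + K" "j < d + K"
    then have "four_block_mat (0\<^sub>m d d) P Q (0\<^sub>m K K) $$ (i, j) =
        (if i < d then if j < d then 0 else P $$ (i, j - d) else if j < d then Q $$ (i - d, j) else 0)"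
      using PQ(1,2) by simp
    then show "Poly_Mapping.keys (four_block_mat (0\<^sub>m d d) P Q (0\<^sub>m K K) $$ (i, j)) \<subseteq> ball (2 ^ k)"
      using ij PQ(4)[of i "j - d"] PQ(5)[of "i - d" j] by (simp del: index_mat_four_block)
  qed simp
  then show ?case
    unfolding zeta_fps_antidiagonal[OF PQ(1,2)] PQ(3) by (rule fps_algebraic_compose_square_cancel)
qed

lemma zeta_fps_algebraic_tree_group:
  fixes M :: "('f \<Rightarrow>\<^sub>0 rat) mat"
  assumes M: "M \<in> carrier_mat d d"
  shows "fps_algebraic (zeta_fps M)"
proof -
  define B where "B = (\<Union>i<d. \<Union>j<d. Poly_Mapping.keys (M $$ (i, j)))"
  \<comment> \<open>For empty \<open>B\<close> the maximum is unspecified, which is harmless: the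
    bound is claimed for elements of \<open>B\<close> only. The radius 2^k suffices because k <
    2^k.\<close>
  define k where "k = Max ((\<lambda>g. length (nf g)) ` B)"
  have "finite B" by (auto simp: B_def)
  then have k: "length (nf g) \<le> k" if "g \<in> B" for g
    using that by (simp add: k_def)
  have "B \<subseteq> ball (2 ^ k)"
    using k less_exp[of k] by (meson in_ball_length less_imp_le order_trans subsetI)
  then show ?thesis
    by (intro zeta_fps_algebraic_ball[OF M, of k]) (auto simp: B_def)
qed

end

section \<open>Passage from free groups and to rational functions\<close>

text \<open>Reduced words of letters become lists of group elements; that only the inverse letter
  can obstruct prefixing is the definition of a reduced word.\<close>

lemma free_on_imp_tree_group:
  assumes free: "free_on I X" and I: "finite I"
  shows "\<exists>nf. tree_group (X ` I) nf"
proof -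
  let ?R = "{w. set w \<subseteq> I \<times> UNIV \<and> reduced_word w}"
  have bij: "bij_betw (eval_word X) ?R UNIV" using free by (simp add: free_on_def)
  define nf where "nf = inv_into ?R (eval_word X)"
  have nf_in: "nf g \<in> ?R" for g
    using bij_betw_inv_into[OF bij] by (auto simp: nf_def bij_betw_def)
  have ev_nf: "eval_word X (nf g) = g" for g
    using bij_betw_inv_into_right[OF bij] by (simp add: nf_def)
  have nf_ev: "nf (eval_word X w) = w" if "w \<in> ?R" for w
    using bij_betw_inv_into_left[OF bij that] by (simp add: nf_def)
  \<comment> \<open>One-letter words are reduced, so distinct letters have distinct values; in
    particular no generator is the inverse of a generator.\<close>
  have letter_inj: "l = l'" if "eval_letter X l = eval_letter X l'" "fst l \<in> I" "fst l' \<in> I" for l l'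
  proof -
    have R: "[l] \<in> ?R" "[l'] \<in> ?R" using that by (auto simp: reduced_word_def mem_Times_iff)
    have "eval_word X [l] = eval_word X [l']" unfolding eval_word_simps that(1) ..
    with nf_ev[OF R(1)] nf_ev[OF R(2)] have "[l] = [l']" by metis
    then show ?thesis by simp
  qed
  have letterE: "\<exists>l. fst l \<in> I \<and> x = eval_letter X l" if "x \<in> X ` I \<union> uminus ` X ` I" for x
    using that by (auto intro: exI[of _ "(_, True)"] exI[of _ "(_, False)"])
  have eval_inv: "eval_letter X (fst l, \<not> snd l) = - eval_letter X l" for l
    by (cases l) auto
  have "tree_group (X ` I) (\<lambda>g. map (eval_letter X) (nf g))"
  proof
    show "finite (X ` I)" using I by simp
  next
    fix x assume "x \<in> X ` I"
    then obtain i where i: "i \<in> I" "x = X i" by blast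
    show "- x \<notin> X ` I"
    proof
      assume "- x \<in> X ` I"
      then obtain j where "j \<in> I" "- x = X j" by blast
      with letter_inj[of "(i, False)" "(j, True)"] i show False by simp
    qed
  next
    have "[] \<in> ?R" by (simp add: reduced_word_def)
    from nf_ev[OF this] show "map (eval_letter X) (nf 0) = []" by simp
  next
    fix g
    show "set (map (eval_letter X) (nf g)) \<subseteq> X ` I \<union> uminus ` X ` I"
    proof
      fix x assume "x \<in> set (map (eval_letter X) (nf g))"
      then obtain l where l: "l \<in> set (nf g)" "x = eval_letter X l" by auto
      from l(1) nf_in[of g] have "fst l \<in> I" by (auto simp: mem_Times_iff)
      with l(2) show "x \<in> X ` I \<union> uminus ` X ` I"
        by (metis UnI1 UnI2 eval_letter.simps imageI prod.collapse)
    qed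
    show "sum_list (map (eval_letter X) (nf g)) = g"
      using ev_nf[of g] by (simp add: eval_word_def)
  next
    fix x g
    assume x: "x \<in> X ` I \<union> uminus ` X ` I" and ne: "\<And>w. map (eval_letter X) (nf g) \<noteq> - x # w"
    obtain l where l: "fst l \<in> I" "x = eval_letter X l" using letterE[OF x] by blast
    have "reduced_word (l # nf g)"
      unfolding reduced_word_Cons
    proof (intro conjI)
      show "reduced_word (nf g)" using nf_in[of g] by simp
      show "nf g = [] \<or> \<not> (fst l = fst (hd (nf g)) \<and> snd l \<noteq> snd (hd (nf g)))"
      proof (cases "nf g")
        case (Cons m v)
        have "m \<noteq> (fst l, \<not> snd l)"
          using ne[of "map (eval_letter X) v"] Cons eval_inv[of l] l(2) by auto
        then show ?thesis using Cons by (cases m) auto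
      qed simp
    qed
    then have "l # nf g \<in> ?R" using nf_in[of g] l(1) by (auto simp: mem_Times_iff)
    from nf_ev[OF this] have "nf (x + g) = l # nf g" by (simp add: l(2) ev_nf)
    then show "map (eval_letter X) (nf (x + g)) = x # map (eval_letter X) (nf g)"
      by (simp add: l(2))
  next
    fix g x w
    assume "map (eval_letter X) (nf g) = x # w"
    then obtain l v where lv: "nf g = l # v" "x = eval_letter X l" "w = map (eval_letter X) v"
      by (cases "nf g") auto
    then have "v \<in> ?R" using nf_in[of g] by (simp add: reduced_word_Cons)
    moreover have "- x + g = eval_word X v"
      using ev_nf[of g] lv by (metis add.assoc add.left_neutral eval_word_simps(2) left_minus)
    ultimately show "map (eval_letter X) (nf (- x + g)) = w"
      using nf_ev lv(3) by metis
  qed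
  then show ?thesis by blast
qed

text \<open>Polynomials are rational functions with denominator 1, and they embed injectively in
  Laurent series, so the equation stays nontrivial.\<close>

lemma fps_algebraic_imp_algebraic_over:
  fixes f :: "'a::field fps"
  assumes "fps_algebraic f"
  shows "algebraic_over rational_fls (fps_to_fls f)"
proof -
  obtain p where p: "p \<noteq> 0" "poly (map_poly fps_of_poly p) f = 0"
    using assms by (auto simp: fps_algebraic_def)
  let ?e = "\<lambda>c :: 'a poly. fps_to_fls (fps_of_poly c)"
  have ev: "poly (map_poly ?e q) (fps_to_fls f) = fps_to_fls (poly (map_poly fps_of_poly q) f)" for q
    by (induction q) (auto simp: map_poly_pCons fls_times_fps_to_fls)
  obtain i where "coeff p i \<noteq> 0" using p(1) by (metis leading_coeff_0_iff)
  then have "fps_of_poly (coeff p i) \<noteq> fps_of_poly 0" by (simp only: fps_of_poly_eq_iff) simp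
  then have "coeff (map_poly ?e p) i \<noteq> 0" by (simp add: coeff_map_poly)
  then have "map_poly ?e p \<noteq> 0" by auto
  moreover have "coeff (map_poly ?e p) i \<in> rational_fls" for i
  proof -
    have "coeff (map_poly ?e p) i = ?e (coeff p i) / ?e 1" by (simp add: coeff_map_poly)
    then show ?thesis unfolding rational_fls_def by (metis (mono_tags, lifting) mem_Collect_eq one_neq_zero)
  qed
  moreover have "poly (map_poly ?e p) (fps_to_fls f) = 0" by (simp add: ev p(2))
  ultimately show ?thesis unfolding algebraic_over_def by blast
qed

theorem theorem1p1:
  fixes X :: "nat \<Rightarrow> 'f::group_add" and r d :: nat
    and M :: "('f \<Rightarrow>\<^sub>0 rat) mat"
  assumes "free_on {1..r} X"
    and "d \<ge> 1"
    and "M \<in> carrier_mat d d"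
  shows "algebraic_over rational_fls (fps_to_fls (zeta_fps M))"
proof -
  obtain nf where "tree_group (X ` {1..r}) nf"
    using free_on_imp_tree_group[OF assms(1)] by auto
  then interpret tree_group "X ` {1..r}" nf .
  show ?thesis
    by (rule fps_algebraic_imp_algebraic_over[OF zeta_fps_algebraic_tree_group[OF assms(3)]])
qed

end
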